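(* Let $v\ge 2$, $\lambda=(\lambda_1,\dots,\lambda_v)$ with all $\lambda_k>0$, and $n\in\{1,\dots,v\}$. Let $q\ge 0$ be an integer and let $\bar e=(e_1,\dots,e_q)$ be nonnegative integers with $\sum_{k=1}^q k\,e_k=q$ (for $q=0$, $\bar e$ is empty). Let $\Xi^{(q;\bar e)}_{\Delta_n}(\rho;\lambda_n)$ denote the corresponding coefficient of the weak truncation expansion of $\Delta_n$, as defined in the context. Then $$\lim_{\rho\to\infty}\operatorname{sign}\,\Xi^{(q;\bar e)}_{\Delta_n}(\rho;\lambda_n)=(-1)^{\sum_{k=1}^q e_k-1}.$$ Consequently, every term of the weak truncation expansion of $\Delta_n$ becomes negative at sufficiently large $\rho$: for every such $q$ and $\bar e$ there is $\rho^*>0$ such that for all $\rho>\rho^*$ $$\frac{\lambda_n^2}{\rho^2}\,(-1)^q\left(\frac{\lambda_n}{\rho}\right)^q\,\Xi^{(q;\bar e)}_{\Delta_n}(\rho;\lambda_n)\,\prod_{k=1}^q\left[\eta_k^{(v-1)}(\rho;\lambda_{(n)})\right]^{e_k}<0 .$$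
   Context: For $d\ge 1$, $\mu=(\mu_1,\dots,\mu_d)\in(0,\infty)^d$ and $\rho>0$, let $\mathcal B_d(\rho)=\{x\in\mathbb R^d:\ x^{T}x<\rho\}$, $\delta(y,\eta)=(2\pi\eta)^{-1/2}e^{-y^2/(2\eta)}$, and $$\alpha^{(d)}(\rho;\mu)=\int_{\mathcal B_d(\rho)}d^dx\ \prod_{j=1}^d\delta(x_j,\mu_j).$$ For $k\ge 1$ define $\eta_k^{(d)}(\rho;\mu)=[\alpha^{(d)}(\rho;\mu)]^{-1}\rho^k\partial_\rho^k\alpha^{(d)}(\rho;\mu)$, and set $\eta_0^{(d)}=1$. Write $\lambda_{(n)}=(\lambda_i)_{i\ne n}\in(0,\infty)^{v-1}$. For $k\ge 0$ let $$\alpha^{(1)}_{n:k}(\rho;\lambda_n)=\int_{-\sqrt\rho}^{\sqrt\rho}dx\ \left(\frac{x^2}{\lambda_n}\right)^k\delta(x,\lambda_n).$$ Quantity of interest: for $X\sim\mathcal N_v(0,\operatorname{diag}(\lambda))$, $$\Delta_n(\rho;\lambda)=\frac1{\rho^2}\left\{\operatorname{var}(X_n^2\,|\,X\in\mathcal B_v(\rho))-2\lambda_n\,\mathbb E[X_n^2\,|\,X\in\mathcal B_v(\rho)]\right\}=\frac{\lambda_n^2}{\rho^2}\cdot\frac{\alpha^{(v)}_{nn}\alpha^{(v)}-\alpha^{(v)}_n\alpha^{(v)}_n-2\alpha^{(v)}_n\alpha^{(v)}}{[\alpha^{(v)}]^2},$$ where $\alpha^{(v)}_{n:k}(\rho;\lambda)=\int_{\mathcal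 B_v(\rho)}d^vx\,(x_n^2/\lambda_n)^k\prod_{j=1}^v\delta(x_j,\lambda_j)$, $\alpha^{(v)}_n=\alpha^{(v)}_{n:1}$, $\alpha^{(v)}_{nn}=\alpha^{(v)}_{n:2}$. Weak truncation expansion. The expansion of $\alpha^{(v)}_{n:k}$ is the formal series $$\alpha^{(v)}_{n:k}(\rho;\lambda)\ \longrightarrow\ \alpha^{(v-1)}(\rho;\lambda_{(n)})\sum_{q\ge 0}\frac{(-1)^q}{q!}\left(\frac{\lambda_n}{\rho}\right)^q\alpha^{(1)}_{n:(k+q)}(\rho;\lambda_n)\,\eta_q^{(v-1)}(\rho;\lambda_{(n)}),$$ and the expansion of an algebraic combination (sum, product, quotient) of such integrals is obtained by the same formal combination of series, ordering by powers of $\lambda_n/\rho$ and by monomials in $\eta_1,\eta_2,\dots$. Precisely, for $\Delta_n$: let $Y_0=1$, let $Y_1,Y_2,\dots$ and $t$ be formal indeterminates and, for fixed $\rho$ and $k=0,1,2$, put $$A_k=\sum_{q\ge 0}\frac{(-1)^q}{q!}\,\alpha^{(1)}_{n:(k+q)}(\rho;\lambda_n)\,Y_q\,t^q\ \in\ \mathbb R[Y_1,Y_2,\dots][[t]].$$ Since the constant term $\alpha^{(1)}_{n:0}(\rho;\lambda_n)$ of $A_0$ is positive, $A_0$ is invertible, and the coefficients $\Xi^{(q;\bar e)}_{\Delta_n}(\rho;\lambda_n)\in\mathbb R$ are defined by $$\frac{A_2A_0-A_1^2-2A_1A_0}{A_0^2}=\sum_{q\ge0}(-1)^q t^q\sum_{\substack{\bar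 e=(e_1,\dots,e_q)\in\mathbb Z_{\ge0}^q\\ \sum_k k e_k=q}}\Xi^{(q;\bar e)}_{\Delta_n}(\rho;\lambda_n)\ Y_1^{e_1}\cdots Y_q^{e_q}.$$ The terms of the weak truncation expansion of $\Delta_n$ are obtained by substituting $t=\lambda_n/\rho$, $Y_k=\eta_k^{(v-1)}(\rho;\lambda_{(n)})$ and multiplying by $\lambda_n^2/\rho^2$. *)

theory Defs
  imports
    "HOL-Analysis.Analysis"
    "HOL-Library.Poly_Mapping"
    "HOL-Computational_Algebra.Formal_Power_Series"
begin

text \<open>
  Points of \<open>\<real>\<^sup>d\<close> are families indexed by a finite set \<open>I\<close> with \<open>d\<close> elements, and \<open>d\<^sup>dx\<close> is the
  product of \<open>I\<close>-many copies of Lebesgue measure. With \<open>I = {1..v} - {n}\<close> the family \<open>\<lambda>\<close> read on \<open>I\<close>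
  is \<open>\<lambda>\<^bsub>(n)\<^esub> = (\<lambda>\<^sub>i)\<^bsub>i \<noteq> n\<^esub>\<close>, so no renumbering is needed.
\<close>

definition ball_I :: "nat set \<Rightarrow> real \<Rightarrow> (nat \<Rightarrow> real) set" where
  "ball_I I \<rho> = {x \<in> I \<rightarrow>\<^sub>E UNIV. (\<Sum>i\<in>I. (x i)\<^sup>2) < \<rho>}"

definition gauss :: "real \<Rightarrow> real \<Rightarrow> real" where
  "gauss y \<eta> = (2 * pi * \<eta>) powr (- 1 / 2) * exp (- y\<^sup>2 / (2 * \<eta>))"

definition alpha :: "nat set \<Rightarrow> real \<Rightarrow> (nat \<Rightarrow> real) \<Rightarrow> real" where
  "alpha I \<rho> \<mu> =
     set_lebesgue_integral (Pi\<^sub>M I (\<lambda>_. lborel)) (ball_I I \<rho>) (\<lambda>x. \<Prod>j\<in>I. gauss (x j) (\<mu> j))"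

definition eta :: "nat set \<Rightarrow> nat \<Rightarrow> real \<Rightarrow> (nat \<Rightarrow> real) \<Rightarrow> real" where
  "eta I k \<rho> \<mu> =
     (if k = 0 then 1 else \<rho> ^ k * (deriv ^^ k) (\<lambda>r. alpha I r \<mu>) \<rho> / alpha I \<rho> \<mu>)"

definition alpha1 :: "nat \<Rightarrow> real \<Rightarrow> real \<Rightarrow> real" where
  "alpha1 k \<rho> l =
     set_lebesgue_integral lborel {- sqrt \<rho>..sqrt \<rho>} (\<lambda>x. (x\<^sup>2 / l) ^ k * gauss x l)"

text \<open>
  The polynomial ring \<open>\<real>[Y\<^sub>1, Y\<^sub>2, \<dots>]\<close>: finitely supported maps from exponent vectors
  (finitely supported maps from variable indices to exponents) to coefficients.
  Index \<open>0\<close> is never used as a variable, since \<open>Y\<^sub>0 = 1\<close>.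
\<close>

type_synonym Ypoly = "(nat \<Rightarrow>\<^sub>0 nat) \<Rightarrow>\<^sub>0 real"

definition Yvar :: "nat \<Rightarrow> Ypoly" where
  "Yvar q = (if q = 0 then 1 else Poly_Mapping.single (Poly_Mapping.single q 1) 1)"

definition Yconst :: "real \<Rightarrow> Ypoly" where
  "Yconst c = Poly_Mapping.single 0 c"

definition wte_A :: "nat \<Rightarrow> real \<Rightarrow> real \<Rightarrow> Ypoly fps" where
  "wte_A k \<rho> l = Abs_fps (\<lambda>q. Yconst ((- 1) ^ q / fact q * alpha1 (k + q) \<rho> l) * Yvar q)"

text \<open>
  The library's division of power series is only meaningful over fields; over \<open>Ypoly\<close> the inverse
  is built from an inverse of the constant term, which here is a nonzero real constant
  (see \<open>wte_Delta_mult\<close> below).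
\<close>

definition wte_A0_inv :: "real \<Rightarrow> real \<Rightarrow> Ypoly fps" where
  "wte_A0_inv \<rho> l = fps_right_inverse (wte_A 0 \<rho> l) (Yconst (1 / alpha1 0 \<rho> l))"

definition wte_Delta :: "real \<Rightarrow> real \<Rightarrow> Ypoly fps" where
  "wte_Delta \<rho> l =
     (wte_A 2 \<rho> l * wte_A 0 \<rho> l - (wte_A 1 \<rho> l)\<^sup>2 - 2 * wte_A 1 \<rho> l * wte_A 0 \<rho> l)
       * (wte_A0_inv \<rho> l)\<^sup>2"

text \<open>
  The coefficient of \<open>t\<^sup>q Y\<^sub>1\<^bsup>e 1\<^esup> \<cdots> Y\<^sub>q\<^bsup>e q\<^esup>\<close>, up to the factor \<open>(-1)\<^sup>q\<close>. Only the values of \<open>e\<close>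
  on \<open>{1..q}\<close> matter.
\<close>

definition Xi :: "nat \<Rightarrow> (nat \<Rightarrow> nat) \<Rightarrow> real \<Rightarrow> real \<Rightarrow> real" where
  "Xi q e \<rho> l =
     (- 1) ^ q * Poly_Mapping.lookup (fps_nth (wte_Delta \<rho> l) q)
                   (\<Sum>k=1..q. Poly_Mapping.single k (e k))"

lemma alpha1_0_pos:
  assumes "\<rho> > 0" "l > 0"
  shows "alpha1 0 \<rho> l > 0"
proof -
  have cont: "continuous_on {- sqrt \<rho>..sqrt \<rho>} (\<lambda>x. gauss x l)"
    unfolding gauss_def using assms by (intro continuous_intros) auto
  have int: "set_integrable lborel {- sqrt \<rho>..sqrt \<rho>} (\<lambda>x. gauss x l)"
    by (rule borel_integrable_atLeastAtMost') (rule cont)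
  have "alpha1 0 \<rho> l = integral {- sqrt \<rho>..sqrt \<rho>} (\<lambda>x. gauss x l)"
    using set_borel_integral_eq_integral(2)[OF int] by (simp add: alpha1_def)
  also have "\<dots> > 0"
  proof -
    have nn: "\<And>x. gauss x l > 0"
      using assms by (simp add: gauss_def)
    have "integral {- sqrt \<rho>..sqrt \<rho>} (\<lambda>x. gauss x l) \<noteq> 0"
      using integral_eq_0_iff[OF cont] nn assms
      by (metis atLeastAtMost_iff less_imp_le less_irrefl neg_le_0_iff_le neg_less_iff_less
          order.strict_trans real_sqrt_gt_zero neg_less_0_iff_less)
    moreover have "integral {- sqrt \<rho>..sqrt \<rho>} (\<lambda>x. gauss x l) \<ge> 0"
      using nn by (intro Henstock_Kurzweil_Integration.integral_nonneg
          integrable_continuous_real cont) (auto intro: less_imp_le)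
    ultimately show ?thesis by simp
  qed
  finally show ?thesis .
qed

lemma wte_Delta_mult:
  assumes "\<rho> > 0" "l > 0"
  shows "wte_Delta \<rho> l * (wte_A 0 \<rho> l)\<^sup>2 =
    wte_A 2 \<rho> l * wte_A 0 \<rho> l - (wte_A 1 \<rho> l)\<^sup>2 - 2 * wte_A 1 \<rho> l * wte_A 0 \<rho> l"
proof -
  have "fps_nth (wte_A 0 \<rho> l) 0 * Yconst (1 / alpha1 0 \<rho> l) = 1"
    using alpha1_0_pos[OF assms] by (simp add: wte_A_def Yvar_def Yconst_def mult_single)
  then have "wte_A 0 \<rho> l * wte_A0_inv \<rho> l = 1"
    unfolding wte_A0_inv_def by (rule fps_right_inverse)
  then have "(wte_A0_inv \<rho> l)\<^sup>2 * (wte_A 0 \<rho> l)\<^sup>2 = 1"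
    by (metis mult.commute power_mult_distrib power_one)
  then show ?thesis
    by (simp add: wte_Delta_def mult.assoc)
qed

end

theory Submission
  imports Defs "HOL-Probability.Distributions" "HOL-Real_Asymp.Real_Asymp"
begin

text \<open>
  The sign of a term is the product of the sign of \<open>\<Xi>\<close> and the signs of the \<open>\<eta>\<^sub>k\<close>; both are
  determined for large \<open>\<rho>\<close>.

  \<^bold>\<open>The coefficients.\<close> As \<open>\<rho> \<rightarrow> \<infinity>\<close> the truncated moment \<open>\<alpha>\<^sup>(\<^sup>1\<^sup>)\<^sub>n\<^sub>:\<^sub>k\<close> tends to the Gaussian moment
  \<open>m\<^sub>k = (2k-1)!!\<close> (\<open>alpha1_tendsto\<close>), and a fixed coefficient of the series for \<open>\<Delta>\<close> depends
  continuously on finitely many moments (\<open>coeffs_tendsto_series_Delta\<close>). In the limit the recurrence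
  \<open>m\<^sub>k\<^sub>+\<^sub>1 = (2k+1) m\<^sub>k\<close> turns into the differential relations \<open>A\<^sub>1 = (1 + 2\<theta>) A\<^sub>0\<close> and
  \<open>A\<^sub>2 = (3 + 2\<theta>) A\<^sub>1\<close> with \<open>\<theta> = t d/dt\<close>, and the expression for \<open>\<Delta>\<close> collapses to
  \<open>4 \<theta>(\<theta>A\<^sub>0 / A\<^sub>0) = 4 \<theta>\<^sup>2 log A\<^sub>0\<close> (\<open>series_Delta_gaussian\<close>). Multiply the coefficient of
  \<open>t\<^sup>q\<close> at a monomial of degree \<open>d\<close> by \<open>(-1)\<^bsup>q+d\<^esup>\<close>. This twist is multiplicative, and after it
  \<open>A\<^sub>0\<close> is \<open>m\<^sub>0\<close> minus a series \<open>W\<close> with nonnegative coefficients, so \<open>1/A\<^sub>0\<close> and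
  \<open>\<theta>W/A\<^sub>0\<close> are nonnegative, and all coefficients at monomials of weight \<open>q\<close> are strictly
  positive for \<open>q > 0\<close> (\<open>signed_coeff_Delta_neg\<close>). For \<open>q = 0\<close> the factor produced by
  \<open>\<theta>\<close> vanishes, so the limit is \<open>0\<close>; there an integration by parts at finite \<open>\<rho>\<close> gives
  the sign (\<open>Delta_order_zero_neg\<close>).

  \<^bold>\<open>The logarithmic derivatives.\<close> Write the Gaussian exponent as \<open>Q(x) = |x|\<^sup>2 R(x)\<close>, with \<open>R\<close>
  constant on rays and bounded between positive constants. Comparing the mass of thin shells gives
  \<open>\<alpha>'(\<rho>) = c \<rho>\<^bsup>d/2-1\<^esup> G(\<rho>)\<close>, where \<open>G(\<rho>)\<close> is the integral of \<open>exp(-\<rho> R)\<close> over the unit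
  ball (\<open>alpha_deriv\<close>). Since \<open>R \<ge> m > 0\<close>, each derivative of \<open>G\<close> is at least \<open>m\<close> times the
  previous one in absolute value. In the Leibniz expansion of \<open>\<alpha>\<^sup>(\<^sup>k\<^sup>)\<close> every derivative that
  falls on the power of \<open>\<rho>\<close> costs a factor \<open>1/\<rho>\<close>, so the term with all of them on \<open>G\<close> wins and
  \<open>\<eta>\<^sub>k\<close> eventually has the sign \<open>(-1)\<^bsup>k-1\<^esup>\<close> (\<open>eta_sign\<close>).
\<close>

section \<open>Coefficients of power series over the polynomial ring\<close>

abbreviation lookup where "lookup \<equiv> Poly_Mapping.lookup"
abbreviation keys where "keys \<equiv> Poly_Mapping.keys"

text \<open>
  Only finitely many pairs matter in a convolution of coefficients, so the formula for the
  coefficient of a product is a finite sum over an index set that does not depend on the factors.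
  This is what makes coefficients of products continuous and compatible with signs.
\<close>

lemma finite_splits: "finite {(a, b). a + b = (s :: nat \<Rightarrow>\<^sub>0 nat)}"
proof -
  define N where "N = (\<Sum>k\<in>keys s. lookup s k)"
  define F where "F = {f :: nat \<Rightarrow> nat.
    \<forall>x. (x \<in> keys s \<longrightarrow> f x \<in> {..N}) \<and> (x \<notin> keys s \<longrightarrow> f x = 0)}"
  have "finite F"
    unfolding F_def by (rule finite_set_of_finite_funs) auto
  moreover have "inj (lookup :: (nat \<Rightarrow>\<^sub>0 nat) \<Rightarrow> nat \<Rightarrow> nat)"
    by (rule injI) (rule poly_mapping_eqI, simp)
  ultimately have fin: "finite (lookup -` F)"
    by (rule finite_vimageI)
  have le: "a \<in> lookup -` F" if "\<And>x. lookup a x \<le> lookup s x" for a :: "nat \<Rightarrow>\<^sub>0 nat"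
  proof -
    have "lookup s x \<le> N" if "x \<in> keys s" for x
      unfolding N_def using that by (intro member_le_sum) auto
    then have "lookup a x \<le> N" if "x \<in> keys s" for x
      using \<open>\<And>x. lookup a x \<le> lookup s x\<close> that order_trans by blast
    moreover have "lookup a x = 0" if "x \<notin> keys s" for x
      using \<open>\<And>x. lookup a x \<le> lookup s x\<close>[of x] that by (simp add: in_keys_iff)
    ultimately show ?thesis unfolding F_def by blast
  qed
  have "{(a, b). a + b = s} \<subseteq> lookup -` F \<times> lookup -` F"
  proof (rule subsetI)
    fix p assume "p \<in> {(a, b). a + b = s}"
    then obtain a b where p: "p = (a, b)" and ab: "a + b = s" by blast
    have "lookup a x + lookup b x = lookup s x" for x
      by (simp add: lookup_add flip: ab)
    then have "a \<in> lookup -` F" "b \<in> lookup -` F"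
      by (metis le le_add1, metis le le_add2)
    then show "p \<in> lookup -` F \<times> lookup -` F" by (simp add: p)
  qed
  then show ?thesis using fin using finite_cartesian_product finite_subset by blast
qed

lemma lookup_mult_splits:
  fixes f g :: Ypoly
  shows "lookup (f * g) s = (\<Sum>(a, b)\<in>{(a, b). a + b = s}. lookup f a * lookup g b)"
proof -
  have "lookup (f * g) s = (\<Sum>(a, b). lookup f a * lookup g b when s = a + b)"
    by (simp add: times_poly_mapping.rep_eq prod_fun_unfold_prod)
  also have "\<dots> = (\<Sum>p\<in>{(a, b). a + b = s}. case p of (a, b) \<Rightarrow> (lookup f a * lookup g b when s = a + b))"
    by (rule Sum_any.expand_superset[OF finite_splits]) (auto simp: when_def split: if_splits)
  also have "\<dots> = (\<Sum>(a, b)\<in>{(a, b). a + b = s}. lookup f a * lookup g b)"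
    by (rule sum.cong) (auto simp: when_def)
  finally show ?thesis .
qed

lemma lookup_of_nat_mult: "lookup (of_nat n * (f :: Ypoly)) s = of_nat n * lookup f s"
  by (induction n) (simp_all add: algebra_simps lookup_add)

lemma lookup_sum: "lookup (\<Sum>i\<in>I. (f i :: 'a \<Rightarrow>\<^sub>0 'b::comm_monoid_add)) s = (\<Sum>i\<in>I. lookup (f i) s)"
  by (induction I rule: infinite_finite_induct) (auto simp: lookup_add)

text \<open>
  The series \<open>A\<^sub>k\<close> and \<open>\<Delta>\<close> for an arbitrary moment sequence \<open>a\<close>. The truncated moments at
  radius \<open>\<rho>\<close> and their limits are two instances, so that letting \<open>\<rho>\<close> tend to infinity becomes
  a statement about varying \<open>a\<close>.
\<close>

definition moment_series :: "(nat \<Rightarrow> real) \<Rightarrow> nat \<Rightarrow> Ypoly fps" where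
  "moment_series a k = Abs_fps (\<lambda>q. Yconst ((- 1) ^ q / fact q * a (k + q)) * Yvar q)"

definition series_inverse :: "(nat \<Rightarrow> real) \<Rightarrow> Ypoly fps" where
  "series_inverse a = fps_right_inverse (moment_series a 0) (Yconst (1 / a 0))"

definition series_Delta :: "(nat \<Rightarrow> real) \<Rightarrow> Ypoly fps" where
  "series_Delta a = (moment_series a 2 * moment_series a 0 - (moment_series a 1)\<^sup>2
     - 2 * moment_series a 1 * moment_series a 0) * (series_inverse a)\<^sup>2"

lemma wte_Delta_eq: "wte_Delta \<rho> l = series_Delta (\<lambda>j. alpha1 j \<rho> l)"
  by (simp add: wte_Delta_def series_Delta_def wte_A_def moment_series_def wte_A0_inv_def
      series_inverse_def)

definition Yexp :: "nat \<Rightarrow> nat \<Rightarrow>\<^sub>0 nat" where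
  "Yexp q = (if q = 0 then 0 else Poly_Mapping.single q 1)"

lemma nth_moment_series:
  "fps_nth (moment_series a k) q = Poly_Mapping.single (Yexp q) ((- 1) ^ q / fact q * a (k + q))"
  by (auto simp: moment_series_def Yconst_def Yvar_def Yexp_def mult_single
      simp flip: single_one)

lemma moment_series_inverse:
  assumes "a 0 \<noteq> 0"
  shows "moment_series a 0 * series_inverse a = 1"
  unfolding series_inverse_def
  by (rule fps_right_inverse)
     (use assms in \<open>simp add: nth_moment_series Yexp_def Yconst_def mult_single\<close>)

section \<open>Coefficientwise convergence\<close>

definition coeffs_tendsto :: "('b \<Rightarrow> Ypoly fps) \<Rightarrow> Ypoly fps \<Rightarrow> 'b filter \<Rightarrow> bool" where
  "coeffs_tendsto F L fl \<longleftrightarrow>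
     (\<forall>q s. ((\<lambda>r. lookup (fps_nth (F r) q) s) \<longlongrightarrow> lookup (fps_nth L q) s) fl)"

lemma coeffs_tendsto_diff:
  "coeffs_tendsto F L fl \<Longrightarrow> coeffs_tendsto G M fl \<Longrightarrow> coeffs_tendsto (\<lambda>r. F r - G r) (L - M) fl"
  by (auto simp: coeffs_tendsto_def lookup_minus intro!: tendsto_diff)

lemma coeffs_tendsto_const: "coeffs_tendsto (\<lambda>r. L) L fl"
  by (auto simp: coeffs_tendsto_def)

lemma tendsto_lookup_mult:
  fixes f g :: "'b \<Rightarrow> Ypoly"
  assumes "\<And>s. ((\<lambda>r. lookup (f r) s) \<longlongrightarrow> lookup f' s) fl"
    and "\<And>s. ((\<lambda>r. lookup (g r) s) \<longlongrightarrow> lookup g' s) fl"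
  shows "((\<lambda>r. lookup (f r * g r) s) \<longlongrightarrow> lookup (f' * g') s) fl"
  unfolding lookup_mult_splits by (auto intro!: tendsto_sum tendsto_mult assms)

lemma coeffs_tendsto_mult:
  assumes "coeffs_tendsto F L fl" "coeffs_tendsto G M fl"
  shows "coeffs_tendsto (\<lambda>r. F r * G r) (L * M) fl"
  using assms unfolding coeffs_tendsto_def fps_mult_nth lookup_sum
  by (auto intro!: tendsto_sum tendsto_lookup_mult)

lemma coeffs_tendsto_moment_series:
  assumes "\<And>j. ((\<lambda>r. a r j) \<longlongrightarrow> m j) fl"
  shows "coeffs_tendsto (\<lambda>r. moment_series (a r) k) (moment_series m k) fl"
  unfolding coeffs_tendsto_def nth_moment_series lookup_single when_def
  by (auto intro!: tendsto_intros assms)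

text \<open>
  The inverse is computed by a recursion in which each coefficient is a product of
  \<open>1/a\<^sub>0\<close> with coefficients of lower order; convergence follows by strong induction on the order.
\<close>

lemma coeffs_tendsto_series_inverse:
  assumes lim: "\<And>j. ((\<lambda>r. a r j) \<longlongrightarrow> m j) fl" and "m 0 \<noteq> 0"
  shows "coeffs_tendsto (\<lambda>r. series_inverse (a r)) (series_inverse m) fl"
proof -
  let ?B = "\<lambda>a. fps_right_inverse_constructor (moment_series a 0) (Yconst (1 / a 0))"
  have A: "((\<lambda>r. lookup (fps_nth (moment_series (a r) 0) i) s)
             \<longlongrightarrow> lookup (fps_nth (moment_series m 0) i) s) fl" for i s
    using coeffs_tendsto_moment_series[OF lim] by (simp add: coeffs_tendsto_def)
  have C: "((\<lambda>r. lookup (Yconst (1 / a r 0)) s) \<longlongrightarrow> lookup (Yconst (1 / m 0)) s) fl" for s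
    unfolding Yconst_def lookup_single when_def using assms by (auto intro!: tendsto_intros)
  have "((\<lambda>r. lookup (?B (a r) q) s) \<longlongrightarrow> lookup (?B m q) s) fl" for q s
  proof (induction q arbitrary: s rule: less_induct)
    case (less q)
    show ?case
    proof (cases q)
      case 0
      then show ?thesis using C by simp
    next
      case (Suc n)
      have "((\<lambda>r. lookup (\<Sum>i = 1..Suc n. fps_nth (moment_series (a r) 0) i * ?B (a r) (Suc n - i)) s)
           \<longlongrightarrow> lookup (\<Sum>i = 1..Suc n. fps_nth (moment_series m 0) i * ?B m (Suc n - i)) s) fl" for s
        unfolding lookup_sum
        by (intro tendsto_sum tendsto_lookup_mult A less.IH) (use Suc in auto)
      moreover have "((\<lambda>r. lookup (- Yconst (1 / a r 0)) s) \<longlongrightarrow> lookup (- Yconst (1 / m 0)) s) fl" for s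
        using C[of s] by (simp add: tendsto_minus)
      ultimately show ?thesis
        unfolding Suc fps_right_inverse_constructor.simps by (rule tendsto_lookup_mult[rotated])
    qed
  qed
  then show ?thesis by (simp add: coeffs_tendsto_def series_inverse_def)
qed

lemma coeffs_tendsto_series_Delta:
  assumes "\<And>j. ((\<lambda>r. a r j) \<longlongrightarrow> m j) fl" and "m 0 \<noteq> 0"
  shows "coeffs_tendsto (\<lambda>r. series_Delta (a r)) (series_Delta m) fl"
  unfolding series_Delta_def power2_eq_square
  by (intro coeffs_tendsto_mult coeffs_tendsto_diff coeffs_tendsto_moment_series
      coeffs_tendsto_series_inverse coeffs_tendsto_const assms)

section \<open>Signed coefficients of the Gaussian limit series\<close>

definition mdeg :: "(nat \<Rightarrow>\<^sub>0 nat) \<Rightarrow> nat" where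
  "mdeg s = (\<Sum>k\<in>keys s. lookup s k)"

definition mweight :: "(nat \<Rightarrow>\<^sub>0 nat) \<Rightarrow> nat" where
  "mweight s = (\<Sum>k\<in>keys s. k * lookup s k)"

lemma mdeg_add: "mdeg (a + b) = mdeg a + mdeg b"
  unfolding mdeg_def by (rule setsum_keys_plus_distrib) auto

lemma mweight_add: "mweight (a + b) = mweight a + mweight b"
  unfolding mweight_def by (rule setsum_keys_plus_distrib) (auto simp: algebra_simps)

lemma mweight_single: "mweight (Poly_Mapping.single k n) = k * n"
  by (simp add: mweight_def)

text \<open>
  The induction step for weights: removing one occurrence of a variable \<open>Y\<^sub>k\<close> lowers the weight
  by \<open>k > 0\<close>.
\<close>

lemma split_variable:
  assumes k: "k \<in> keys s" and s: "0 \<notin> keys s"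
  obtains s' where "Poly_Mapping.single k 1 + s' = s" "mweight s' + k = mweight s" "0 \<notin> keys s'" "k > 0"
proof -
  define s' where "s' = s - Poly_Mapping.single k 1"
  have ss: "Poly_Mapping.single k 1 + s' = s"
    using k by (intro poly_mapping_eqI)
      (auto simp: s'_def lookup_add lookup_minus lookup_single when_def in_keys_iff)
  have "k > 0" using k s by (metis gr0I)
  moreover have "mweight s' + k = mweight s"
    using mweight_add[of "Poly_Mapping.single k 1" s'] unfolding ss by (simp add: mweight_single)
  moreover have "0 \<notin> keys s'"
    using s by (auto simp: s'_def in_keys_iff lookup_minus)
  ultimately show ?thesis using that ss by blast
qed

text \<open>
  The sign is that of the substitution \<open>t \<mapsto> -t\<close>, \<open>Y\<^sub>k \<mapsto> -Y\<^sub>k\<close>, a ring automorphism. Hence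
  products of series are still computed by convolution, and nonnegativity of signed coefficients
  is preserved under multiplication.
\<close>

definition signed_coeff :: "Ypoly fps \<Rightarrow> nat \<Rightarrow> (nat \<Rightarrow>\<^sub>0 nat) \<Rightarrow> real" where
  "signed_coeff F q s = (- 1) ^ (q + mdeg s) * lookup (fps_nth F q) s"

lemma signed_coeff_mult:
  "signed_coeff (F * G) q s =
     (\<Sum>i\<le>q. \<Sum>(a, b)\<in>{(a, b). a + b = s}. signed_coeff F i a * signed_coeff G (q - i) b)"
proof -
  have *: "(- 1 :: real) ^ (q + mdeg (a + b)) * (x * y) =
      (- 1) ^ (i + mdeg a) * x * ((- 1) ^ (q - i + mdeg b) * y)"
    if "i \<le> q" for i a b x y
  proof -
    have "q + mdeg (a + b) = (i + mdeg a) + (q - i + mdeg b)"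
      using that by (auto simp: mdeg_add)
    then show ?thesis by (simp only: power_add) (simp add: algebra_simps)
  qed
  show ?thesis
    unfolding signed_coeff_def fps_mult_nth lookup_sum lookup_mult_splits sum_distrib_left atLeast0AtMost
    by (intro sum.cong refl) (safe, simp only: * atMost_iff)
qed

lemma signed_coeff_mult_nonneg:
  assumes "\<And>i a b. i \<le> q \<Longrightarrow> a + b = s \<Longrightarrow> signed_coeff F i a * signed_coeff G (q - i) b \<ge> 0"
  shows "signed_coeff (F * G) q s \<ge> 0"
  unfolding signed_coeff_mult by (intro sum_nonneg) (clarsimp simp: assms)

lemma signed_coeff_mult_pos:
  assumes nn: "\<And>i a b. i \<le> q \<Longrightarrow> a + b = s \<Longrightarrow> signed_coeff F i a * signed_coeff G (q - i) b \<ge> 0"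
    and "i \<le> q" "a + b = s" "signed_coeff F i a * signed_coeff G (q - i) b > 0"
  shows "signed_coeff (F * G) q s > 0"
  unfolding signed_coeff_mult
proof (rule sum_pos2[where i = i])
  show "(\<Sum>(a, b)\<in>{(a, b). a + b = s}. signed_coeff F i a * signed_coeff G (q - i) b) > 0"
  proof (rule sum_pos2[where i = "(a, b)"])
    show "(case p of (a, b) \<Rightarrow> signed_coeff F i a * signed_coeff G (q - i) b) \<ge> 0"
      if "p \<in> {(a, b). a + b = s}" for p
      using that \<open>i \<le> q\<close> by (cases p) (simp add: nn)
  qed (simp_all add: assms finite_splits)
  show "(\<Sum>(a, b)\<in>{(a, b). a + b = s}. signed_coeff F i a * signed_coeff G (q - i) b) \<ge> 0"
    if "i \<in> {..q}" for i
    using that by (intro sum_nonneg) (clarsimp simp: nn)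
qed (simp_all add: \<open>i \<le> q\<close>)

lemma signed_coeff_add: "signed_coeff (F + G) q s = signed_coeff F q s + signed_coeff G q s"
  and signed_coeff_uminus: "signed_coeff (- F) q s = - signed_coeff F q s"
  by (auto simp: signed_coeff_def lookup_add algebra_simps)

lemma fps_nth_of_nat_mult: "fps_nth (of_nat n * F) q = of_nat n * fps_nth (F :: Ypoly fps) q"
  by (simp only: fps_of_nat[symmetric] fps_mult_left_const_nth)

lemma signed_coeff_of_nat_mult: "signed_coeff (of_nat n * F) q s = real n * signed_coeff F q s"
  by (simp only: signed_coeff_def fps_nth_of_nat_mult lookup_of_nat_mult mult.left_commute)

lemma signed_coeff_one: "signed_coeff 1 q s = (if q = 0 \<and> s = 0 then 1 else 0)"
  by (auto simp: signed_coeff_def lookup_one when_def mdeg_def)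

definition theta :: "Ypoly fps \<Rightarrow> Ypoly fps" where
  "theta F = fps_X * fps_deriv F"

lemma nth_theta: "fps_nth (theta F) q = of_nat q * fps_nth F q"
  by (cases q) (auto simp: theta_def)

lemma theta_add: "theta (F + G) = theta F + theta G"
  and theta_mult: "theta (F * G) = theta F * G + F * theta G"
  and theta_one: "theta 1 = 0"
  and theta_uminus: "theta (- F) = - theta F"
  by (simp_all add: theta_def algebra_simps)

lemma signed_coeff_theta: "signed_coeff (theta F) q s = real q * signed_coeff F q s"
  by (simp add: signed_coeff_def nth_theta lookup_of_nat_mult)

text \<open>
  On the coefficient of \<open>t\<^sup>q\<close> the operator \<open>\<theta>\<close> acts as multiplication by \<open>q\<close>, so the moment
  recurrence \<open>m\<^sub>k\<^sub>+\<^sub>q\<^sub>+\<^sub>1 = (2k + 1 + 2q) m\<^sub>k\<^sub>+\<^sub>q\<close> reads \<open>A\<^sub>k\<^sub>+\<^sub>1 = (2k + 1 + 2\<theta>) A\<^sub>k\<close>.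
\<close>

lemma moment_series_Suc:
  assumes "\<And>j. m (Suc j) = (2 * real j + 1) * m j"
  shows "moment_series m (Suc k) =
    of_nat (2 * k + 1) * moment_series m k + theta (moment_series m k) + theta (moment_series m k)"
proof (rule fps_ext)
  fix q
  have "fps_nth (of_nat (2 * k + 1) * moment_series m k + theta (moment_series m k)
          + theta (moment_series m k)) q
      = of_nat (2 * k + 1) * fps_nth (moment_series m k) q 
          + of_nat q * fps_nth (moment_series m k) q + of_nat q * fps_nth (moment_series m k) q"
    by (simp only: fps_add_nth fps_nth_of_nat_mult nth_theta)
  also have "\<dots> = of_nat (2 * (k + q) + 1) * fps_nth (moment_series m k) q"
    by (simp add: distrib_right)
  also have "\<dots> = fps_nth (moment_series m (Suc k)) q"
    by (rule poly_mapping_eqI)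
       (simp only: lookup_of_nat_mult, simp add: nth_moment_series assms lookup_single when_def)
  finally show "fps_nth (moment_series m (Suc k)) q = 
    fps_nth (of_nat (2 * k + 1) * moment_series m k + theta (moment_series m k) + theta (moment_series m k)) q" ..
qed

text \<open>
  With \<open>T = \<theta>A\<^sub>0\<close> the numerator of \<open>\<Delta>\<close> becomes \<open>4 (A\<^sub>0 \<theta>T - T\<^sup>2)\<close>: the multiples of
  \<open>A\<^sub>0\<^sup>2\<close> and \<open>A\<^sub>0 T\<close> cancel. Divided by \<open>A\<^sub>0\<^sup>2\<close> this is the quotient rule for
  \<open>4 \<theta>(T/A\<^sub>0)\<close>.
\<close>

lemma series_Delta_gaussian:
  assumes rec: "\<And>j. m (Suc j) = (2 * real j + 1) * m j" and "m 0 \<noteq> 0"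
  shows "series_Delta m = 4 * theta (theta (moment_series m 0) * series_inverse m)"
proof -
  define A B where "A = moment_series m 0" and "B = series_inverse m"
  define T U where "T = theta A" and "U = theta T"
  have A1: "moment_series m 1 = A + T + T"
    using moment_series_Suc[OF rec, where k = 0] by (simp add: A_def T_def)
  have "moment_series m 2 = of_nat 3 * (A + T + T) + (T + U + U) + (T + U + U)"
    using moment_series_Suc[OF rec, where k = 1]
    unfolding One_nat_def[symmetric] Suc_1 A1 theta_add T_def U_def by simp
  then have A2: "moment_series m 2 = 3 * A + 8 * T + 4 * U"
    by (simp add: algebra_simps)
  have AB: "A * B = 1"
    using moment_series_inverse[of m] assms by (simp add: A_def B_def)
  have "T * B + A * theta B = 0"
    using theta_mult[of A B] by (simp add: AB theta_one T_def)
  then have "(T * B + A * theta B) * B = 0" by simp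
  then have "T * B * B + (A * B) * theta B = 0" by (simp only: algebra_simps)
  \<comment> \<open>The derivative of the reciprocal, obtained by differentiating \<open>A B = 1\<close>.\<close>
  then have tB: "theta B = - (T * B * B)" by (simp add: AB eq_neg_iff_add_eq_0 add.commute)
  have "series_Delta m = 4 * (U * (A * B) * B - T * T * B * B)"
    unfolding series_Delta_def A1 A2 A_def[symmetric] B_def[symmetric]
    by (simp add: power2_eq_square algebra_simps)
  also have "\<dots> = 4 * (U * B + T * theta B)"
    by (simp add: AB tB algebra_simps)
  also have "\<dots> = 4 * theta (T * B)"
    by (simp add: theta_mult U_def)
  finally show ?thesis by (simp add: A_def B_def T_def)
qed

context
  fixes m :: "nat \<Rightarrow> real"
  assumes pos: "\<And>j. m j > 0"
begin

text \<open>
  The nonconstant part of \<open>A\<^sub>0\<close> with the opposite sign. Its coefficient at \<open>Y\<^sub>q t\<^sup>q\<close> is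
  \<open>-(-1)\<^sup>q m\<^sub>q/q!\<close>, which the signed coefficient turns into a positive number.
\<close>

definition "W = fps_const (Yconst (m 0)) - moment_series m 0"

lemma signed_coeff_W:
  "signed_coeff W q s = (if q > 0 \<and> s = Poly_Mapping.single q 1 then m q / fact q else 0)"
proof -
  have "mdeg (Poly_Mapping.single q 1) = 1" by (simp add: mdeg_def)
  then show ?thesis
  by (auto simp: W_def signed_coeff_def nth_moment_series Yconst_def lookup_minus lookup_single when_def Yexp_def
      simp flip: power_add power_mult_distrib)
qed

text \<open>
  Since \<open>A\<^sub>0 = m\<^sub>0 - W\<close>, the inverse \<open>B\<close> satisfies \<open>m\<^sub>0 B = 1 + W B\<close>, a recursion with
  nonnegative terms. At a monomial of weight \<open>q\<close>, splitting off any of its variables exhibits a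
  strictly positive term. The condition on the index \<open>0\<close> is there because \<open>Y\<^sub>0\<close> stands for \<open>1\<close>.
\<close>

lemma signed_coeff_inverse_nonneg_pos:
  "signed_coeff (series_inverse m) q s \<ge> 0 \<and>
    (0 \<notin> keys s \<longrightarrow> mweight s = q \<longrightarrow> signed_coeff (series_inverse m) q s > 0)"
proof (induction q arbitrary: s rule: less_induct)
  case (less q)
  let ?B = "series_inverse m"
  have IH: "signed_coeff ?B i t \<ge> 0" "0 \<notin> keys t \<Longrightarrow> mweight t = i \<Longrightarrow> signed_coeff ?B i t > 0"
    if "i < q" for i t
    using less that by blast+
  have "moment_series m 0 * ?B = 1"
    using moment_series_inverse[of m] pos[of 0] by simp
  then have "fps_const (Yconst (m 0)) * ?B = 1 + W * ?B"
    by (simp add: W_def algebra_simps)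
  moreover have "signed_coeff (fps_const (Yconst c) * F) q s = c * signed_coeff F q s" for c F
  proof -
    have "lookup (Poly_Mapping.single 0 c * f) s = c * lookup f s" for f :: Ypoly
      by transfer' (simp add: prod_fun_def when_mult)
    then show ?thesis by (simp add: signed_coeff_def Yconst_def)
  qed
  ultimately have eq: "m 0 * signed_coeff ?B q s = signed_coeff 1 q s + signed_coeff (W * ?B) q s"
    by (metis signed_coeff_add)
  have nn: "signed_coeff W i a * signed_coeff ?B (q - i) b \<ge> 0" if "i \<le> q" for i a b
    using that IH(1)[of "q - i" b] pos[of i] by (auto simp: signed_coeff_W less_imp_le)
  have W: "signed_coeff (W * ?B) q s \<ge> 0"
    by (rule signed_coeff_mult_nonneg) (rule nn)
  have 1: "signed_coeff ?B q s \<ge> 0"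
  proof -
    have "m 0 * signed_coeff ?B q s \<ge> 0"
      using W eq by (simp add: signed_coeff_one)
    then show ?thesis using pos[of 0] by (simp add: zero_le_mult_iff)
  qed
  have 2: "signed_coeff ?B q s > 0" if s: "0 \<notin> keys s" "mweight s = q"
  proof (cases "s = 0")
    case True
    then have "q = 0" using s by (simp add: mweight_def)
    then have "m 0 * signed_coeff ?B q s > 0"
      using True W eq by (simp add: signed_coeff_one)
    then show ?thesis using pos[of 0] by (simp add: zero_less_mult_iff)
  next
    case False
    then obtain k where k: "k \<in> keys s" by fastforce
    obtain s' where s': "Poly_Mapping.single k 1 + s' = s" "mweight s' + k = q" "0 \<notin> keys s'" "k > 0"
      using split_variable[OF k] s by metis
    then have "signed_coeff ?B (q - k) s' > 0"
      by (intro IH(2)) auto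
    then have "signed_coeff (W * ?B) q s > 0"
      using s' pos[of k]
      by (intro signed_coeff_mult_pos[OF nn, where i = k and a = "Poly_Mapping.single k 1" and b = s'])
         (auto simp: signed_coeff_W)
    then have "m 0 * signed_coeff ?B q s > 0"
      using eq False by (simp add: signed_coeff_one)
    then show ?thesis using pos[of 0] by (simp add: zero_less_mult_iff)
  qed
  show ?case using 1 2 by blast
qed

text \<open>
  Here \<open>\<Delta> = -4 \<theta>(\<theta>W \<cdot> B)\<close>, and the outer \<open>\<theta>\<close> multiplies by \<open>q\<close>; this is why order zero is
  excluded.
\<close>

lemma signed_coeff_Delta_neg:
  assumes rec: "\<And>j. m (Suc j) = (2 * real j + 1) * m j"
    and s: "0 \<notin> keys s" "mweight s = q" and q: "q > 0"
  shows "signed_coeff (series_Delta m) q s < 0"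
proof -
  let ?B = "series_inverse m"
  have "theta (fps_const c) = 0" for c by (simp add: theta_def)
  then have "theta (moment_series m 0) = - theta W"
    by (simp add: W_def theta_def)
  then have "series_Delta m = - (4 * theta (theta W * ?B))"
    using series_Delta_gaussian[OF rec] pos[of 0] by (simp add: theta_uminus)
  then have eq: "signed_coeff (series_Delta m) q s = - (4 * (real q * signed_coeff (theta W * ?B) q s))"
    using signed_coeff_of_nat_mult[of 4] by (simp add: signed_coeff_uminus signed_coeff_theta)
  have nn: "signed_coeff (theta W) i a * signed_coeff ?B (q - i) b \<ge> 0" if "i \<le> q" for i a b
    using signed_coeff_inverse_nonneg_pos[of "q - i" b] pos[of i]
    by (auto simp: signed_coeff_theta signed_coeff_W less_imp_le)
  have "keys s \<noteq> {}" using s q by (auto simp: mweight_def)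
  then obtain k where k: "k \<in> keys s" by blast
  obtain s' where s': "Poly_Mapping.single k 1 + s' = s" "mweight s' + k = q" "0 \<notin> keys s'" "k > 0"
    using split_variable[OF k] s by metis
  have "signed_coeff ?B (q - k) s' > 0"
    using s' signed_coeff_inverse_nonneg_pos by auto
  then have "signed_coeff (theta W * ?B) q s > 0"
    using s' pos[of k]
    by (intro signed_coeff_mult_pos[OF nn, where i = k and a = "Poly_Mapping.single k 1" and b = s'])
       (auto simp: signed_coeff_W signed_coeff_theta)
  then show ?thesis using eq q by simp
qed

end

section \<open>Truncated moments of a Gaussian variable\<close>

lemma gauss_pos: "l > 0 \<Longrightarrow> gauss x l > 0"
  by (simp add: gauss_def)

lemma gauss_deriv:
  assumes "l > 0"
  shows "((\<lambda>x. gauss x l) has_real_derivative - x / l * gauss x l) (at x within S)"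
  unfolding gauss_def using assms by (auto intro!: derivative_eq_intros simp: field_simps)

lemma continuous_on_gauss: "l > 0 \<Longrightarrow> continuous_on S (\<lambda>x. gauss x l)"
  unfolding gauss_def by (intro continuous_intros) auto

text \<open>
  Integration by parts: \<open>x (x\<^sup>2/l)\<^sup>k \<delta>(x, l)\<close> has derivative
  \<open>(2k+1) (x\<^sup>2/l)\<^sup>k \<delta> - (x\<^sup>2/l)\<^bsup>k+1\<^esup> \<delta>\<close>. The boundary term is kept, since it decides the
  sign at order zero.
\<close>

lemma alpha1_Suc:
  assumes "\<rho> > 0" "l > 0"
  shows "alpha1 (Suc k) \<rho> l
    = (2 * real k + 1) * alpha1 k \<rho> l - 2 * sqrt \<rho> * (\<rho> / l) ^ k * gauss (sqrt \<rho>) l"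
proof -
  let ?I = "{- sqrt \<rho>..sqrt \<rho>}"
  have int: "set_integrable lborel ?I (\<lambda>x. (x\<^sup>2 / l) ^ k * gauss x l)" for k
    by (intro borel_integrable_atLeastAtMost' continuous_intros continuous_on_gauss) (use assms in auto)
  define F where "F = (\<lambda>x. x ^ (2 * k + 1) / l ^ k * gauss x l)"
  have F': "(F has_real_derivative ((2 * real k + 1) * ((x\<^sup>2 / l) ^ k * gauss x l)
       - (x\<^sup>2 / l) ^ Suc k * gauss x l)) (at x)" for x
  proof -
    have pow: "((\<lambda>x. x ^ (2 * k + 1)) has_real_derivative (2 * real k + 1) * x ^ (2 * k)) (at x)"
      using DERIV_pow[of "2 * k + 1" x UNIV] by (simp add: add.commute)
    show ?thesis
      unfolding F_def
      by (rule DERIV_cong[OF DERIV_mult[OF DERIV_cdivide[OF pow] gauss_deriv[OF assms(2)]]])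
         (use assms in \<open>simp add: field_simps power_mult power_divide power2_eq_square\<close>)
  qed
  have "F (sqrt \<rho>) - F (- sqrt \<rho>) = (LBINT x:?I. (2 * real k + 1) * ((x\<^sup>2 / l) ^ k * gauss x l)
       - (x\<^sup>2 / l) ^ Suc k * gauss x l)"
    unfolding set_lebesgue_integral_def real_scaleR_def mult.commute[of "indicator _ _"]
  proof (rule integral_FTC_Icc_real[symmetric])
    have "continuous_on UNIV (\<lambda>x. (2 * real k + 1) * ((x\<^sup>2 / l) ^ k * gauss x l)
       - (x\<^sup>2 / l) ^ Suc k * gauss x l)"
      using assms by (intro continuous_intros continuous_on_gauss) auto
    then show "isCont (\<lambda>x. (2 * real k + 1) * ((x\<^sup>2 / l) ^ k * gauss x l)
       - (x\<^sup>2 / l) ^ Suc k * gauss x l) x" for x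
      by (simp add: continuous_on_eq_continuous_at)
  qed (use assms F' in auto)
  also have "\<dots> = (2 * real k + 1) * alpha1 k \<rho> l - alpha1 (Suc k) \<rho> l"
    unfolding alpha1_def using int[of k] int[of "Suc k"]
    by (subst set_integral_diff) auto
  also have "F (- sqrt \<rho>) = - F (sqrt \<rho>)"
    by (simp add: F_def gauss_def)
  also have "F (sqrt \<rho>) = sqrt \<rho> * (\<rho> / l) ^ k * gauss (sqrt \<rho>) l"
    using assms by (simp add: F_def power_mult power_divide)
  finally show ?thesis by (simp add: algebra_simps)
qed

lemma alpha1_0_tendsto:
  assumes "l > 0"
  shows "((\<lambda>\<rho>. alpha1 0 \<rho> l) \<longlongrightarrow> 1) at_top"
proof -
  have eq: "gauss x l = normal_density 0 (sqrt l) x" for x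
    using assms by (simp add: gauss_def normal_density_def powr_minus_divide powr_half_sqrt)
  have "((\<lambda>\<rho>. \<integral>x. indicator {- sqrt \<rho>..sqrt \<rho>} x *\<^sub>R gauss x l \<partial>lborel) \<longlongrightarrow> (\<integral>x. gauss x l \<partial>lborel)) at_top"
  proof (rule integral_dominated_convergence_at_top[where w = "\<lambda>x. gauss x l"])
    have "eventually (\<lambda>\<rho>. indicator {- sqrt \<rho>..sqrt \<rho>} x *\<^sub>R gauss x l = gauss x l) at_top" for x
      using eventually_ge_at_top[of "x\<^sup>2"]
    proof eventually_elim
      case (elim \<rho>)
      then have "\<bar>x\<bar> \<le> sqrt \<rho>" by (metis real_le_rsqrt power2_abs)
      then show ?case by (auto simp: indicator_def abs_le_iff)
    qed
    then show "AE x in lborel. ((\<lambda>\<rho>. indicator {- sqrt \<rho>..sqrt \<rho>} x *\<^sub>R gauss x l) \<longlongrightarrow> gauss x l) at_top"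
      by (auto intro!: AE_I2 tendsto_eventually)
    show "\<forall>\<^sub>F \<rho> in at_top. AE x in lborel. norm (indicator {- sqrt \<rho>..sqrt \<rho>} x *\<^sub>R gauss x l) \<le> gauss x l"
      using assms by (auto intro!: always_eventually AE_I2 simp: indicator_def eq normal_density_nonneg)
  qed (use assms in \<open>auto simp: eq\<close>)
  then show ?thesis
    using assms by (simp add: alpha1_def set_lebesgue_integral_def eq)
qed

text \<open>
  The double factorial \<open>(2k-1)!!\<close>, the moment of order \<open>2k\<close> of a standard normal variable.
\<close>

fun normal_even_moment :: "nat \<Rightarrow> real" where
  "normal_even_moment 0 = 1"
| "normal_even_moment (Suc k) = (2 * real k + 1) * normal_even_moment k"

lemma normal_even_moment_pos: "normal_even_moment k > 0"
  by (induction k) auto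

lemma alpha1_tendsto:
  assumes "l > 0"
  shows "((\<lambda>\<rho>. alpha1 k \<rho> l) \<longlongrightarrow> normal_even_moment k) at_top"
proof (induction k)
  case 0
  then show ?case using alpha1_0_tendsto[OF assms] by simp
next
  case (Suc k)
  have "((\<lambda>\<rho>. 2 * sqrt \<rho> * (\<rho> / l) ^ k * gauss (sqrt \<rho>) l) \<longlongrightarrow> 0) at_top"
  proof -
    have "((\<lambda>\<rho>. 2 * sqrt \<rho> * (\<rho> / l) ^ k * ((2 * pi * l) powr (- 1 / 2) * exp (- \<rho> / (2 * l)))) \<longlongrightarrow> 0) at_top"
      using assms by real_asymp
    then show ?thesis
      by (rule Lim_transform_eventually)
         (auto simp: gauss_def intro!: eventually_mono[OF eventually_ge_at_top[of 0]])
  qed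
  then have "((\<lambda>\<rho>. (2 * real k + 1) * alpha1 k \<rho> l - 2 * sqrt \<rho> * (\<rho> / l) ^ k * gauss (sqrt \<rho>) l)
     \<longlongrightarrow> (2 * real k + 1) * normal_even_moment k - 0) at_top"
    by (intro tendsto_diff tendsto_mult tendsto_const Suc.IH)
  moreover have "\<forall>\<^sub>F \<rho> in at_top. (2 * real k + 1) * alpha1 k \<rho> l
      - 2 * sqrt \<rho> * (\<rho> / l) ^ k * gauss (sqrt \<rho>) l = alpha1 (Suc k) \<rho> l"
    using eventually_gt_at_top[of 0] by eventually_elim (simp add: alpha1_Suc assms)
  ultimately have "((\<lambda>\<rho>. alpha1 (Suc k) \<rho> l) \<longlongrightarrow> (2 * real k + 1) * normal_even_moment k - 0) at_top"
    by (rule Lim_transform_eventually)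
  then show ?case by simp
qed

text \<open>
  Expressing the moments of order 1 and 2 through order 0 by the recurrence leaves the boundary
  term times \<open>a\<^sub>1 - (\<rho>/l) a\<^sub>0\<close>. This is negative for large \<open>\<rho>\<close>, as \<open>a\<^sub>0\<close> and \<open>a\<^sub>1\<close> tend to 1.
\<close>

lemma Delta_order_zero_neg:
  assumes "l > 0"
  shows "\<forall>\<^sub>F \<rho> in at_top.
    alpha1 2 \<rho> l * alpha1 0 \<rho> l - (alpha1 1 \<rho> l)\<^sup>2 - 2 * alpha1 1 \<rho> l * alpha1 0 \<rho> l < 0"
proof -
  have big: "filterlim (\<lambda>\<rho>. \<rho> / l * alpha1 0 \<rho> l) at_top at_top"
    by (rule filterlim_at_top_mult_tendsto_pos[OF alpha1_0_tendsto[OF assms]])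
       (use assms in \<open>simp, real_asymp\<close>)
  have "\<forall>\<^sub>F \<rho> in at_top. alpha1 1 \<rho> l < 2"
    using order_tendstoD(2)[OF alpha1_tendsto[OF assms, of 1], of 2] by simp
  moreover have "\<forall>\<^sub>F \<rho> in at_top. \<rho> / l * alpha1 0 \<rho> l > 2"
    using big by (simp add: filterlim_at_top_dense)
  ultimately show ?thesis
    using eventually_gt_at_top[of 0]
  proof eventually_elim
    case (elim \<rho>)
    let ?c = "2 * sqrt \<rho> * gauss (sqrt \<rho>) l"
    have 1: "alpha1 1 \<rho> l = alpha1 0 \<rho> l - ?c"
      using alpha1_Suc[OF elim(3) assms, of 0] by simp
    have 2: "alpha1 2 \<rho> l = 3 * alpha1 1 \<rho> l - \<rho> / l * ?c"
      using alpha1_Suc[OF elim(3) assms, of 1] by (simp add: numeral_2_eq_2)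
    have "alpha1 2 \<rho> l * alpha1 0 \<rho> l - (alpha1 1 \<rho> l)\<^sup>2 - 2 * alpha1 1 \<rho> l * alpha1 0 \<rho> l
      = ?c * (alpha1 1 \<rho> l - \<rho> / l * alpha1 0 \<rho> l)"
      unfolding 2 1 by (simp add: power2_eq_square algebra_simps)
    also have "\<dots> < 0"
      using elim gauss_pos[OF assms] by (intro mult_pos_neg) auto
    finally show ?case .
  qed
qed

section \<open>Laplace transforms of measures supported away from zero\<close>

lemma has_real_derivative_quadratic_error:
  fixes f :: "real \<Rightarrow> real"
  assumes "\<delta> > 0" and err: "\<And>h. \<bar>h\<bar> \<le> \<delta> \<Longrightarrow> \<bar>f (x + h) - f x - h * D\<bar> \<le> C * h\<^sup>2"
  shows "(f has_real_derivative D) (at x)"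
proof -
  have "((\<lambda>h. (f (x + h) - f x) / h - D) \<longlongrightarrow> 0) (at 0)"
  proof (rule Lim_null_comparison)
    have "\<forall>\<^sub>F h in at 0. \<bar>h\<bar> < \<delta> \<and> h \<noteq> 0"
      unfolding eventually_at using \<open>\<delta> > 0\<close> by (auto simp: dist_real_def)
    then show "\<forall>\<^sub>F h in at 0. norm ((f (x + h) - f x) / h - D) \<le> C * \<bar>h\<bar>"
    proof eventually_elim
      case (elim h)
      have "norm ((f (x + h) - f x) / h - D) = \<bar>f (x + h) - f x - h * D\<bar> / \<bar>h\<bar>"
        using elim by (simp add: field_simps flip: abs_divide)
      also have "\<dots> \<le> C * h\<^sup>2 / \<bar>h\<bar>"
        using elim err[of h] by (intro divide_right_mono) auto
      also have "\<dots> = C * \<bar>h\<bar>"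
        using elim by (simp add: power2_eq_square abs_if)
      finally show ?case .
    qed
    show "((\<lambda>h. C * \<bar>h\<bar>) \<longlongrightarrow> 0) (at 0)"
      by (auto intro!: tendsto_eq_intros)
  qed
  then show ?thesis unfolding DERIV_def by (rule LIM_zero_cancel)
qed

text \<open>
  The upper bound is \<open>exp x \<le> 1/(1 - x)\<close> together with \<open>1/(1 - x) \<le> 1 + x + 2x\<^sup>2\<close>.
\<close>

lemma exp_quadratic_bound:
  fixes x :: real
  assumes "\<bar>x\<bar> \<le> 1 / 2"
  shows "\<bar>exp x - 1 - x\<bar> \<le> 2 * x\<^sup>2"
proof -
  have lower: "1 + x \<le> exp x" by (rule exp_ge_add_one_self)
  have "(1 + x + 2 * x\<^sup>2) * (1 - x) = 1 + x\<^sup>2 * (1 - 2 * x)"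
    by (simp add: power2_eq_square algebra_simps)
  also have "\<dots> \<ge> 1" using assms by simp
  finally have "1 \<le> (1 + x + 2 * x\<^sup>2) * (1 - x)" .
  moreover have "0 \<le> 1 + x + 2 * x\<^sup>2"
  proof -
    have "0 \<le> 1 + x" using assms by linarith
    then show ?thesis by simp
  qed
  moreover have "1 - x \<le> exp (- x)"
    using exp_ge_add_one_self[of "- x"] by simp
  ultimately have "1 \<le> (1 + x + 2 * x\<^sup>2) * exp (- x)"
    by (meson mult_left_mono order_trans)
  then have "exp x \<le> 1 + x + 2 * x\<^sup>2"
    by (simp add: exp_minus field_simps)
  with lower show ?thesis using zero_le_power2[of x] by linarith
qed

text \<open>
  A finite measure with a rate function between positive constants. The lower bound \<open>m\<close> controls
  the ratio of consecutive derivatives of the Laplace transform, the upper bound \<open>K\<close> makes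
  differentiation under the integral sign elementary.
\<close>

locale bounded_rate = finite_measure N for N :: "'a measure" +
  fixes R :: "'a \<Rightarrow> real" and m K :: real
  assumes R_meas [measurable]: "R \<in> borel_measurable N"
    and m_pos: "m > 0"
    and R_ge: "\<And>x. x \<in> space N \<Longrightarrow> m \<le> R x"
    and R_le: "\<And>x. x \<in> space N \<Longrightarrow> R x \<le> K"
    and nontrivial: "measure N (space N) > 0"
begin

text \<open>
  Up to the factor \<open>(-1)\<^sup>j\<close>, the derivative of order \<open>j\<close> of the Laplace transform of \<open>R\<close>.
\<close>

definition G :: "nat \<Rightarrow> real \<Rightarrow> real" where
  "G j r = (\<integral>x. R x ^ j * exp (- (r * R x)) \<partial>N)"

lemma space_ne: "space N \<noteq> {}"
  using nontrivial by auto

lemma K_pos: "K > 0"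
  using R_ge R_le space_ne m_pos by (meson ex_in_conv less_le_trans)

lemma integrable_G: "integrable N (\<lambda>x. R x ^ j * exp (- (r * R x)))"
proof (rule integrable_const_bound)
  show "AE x in N. norm (R x ^ j * exp (- (r * R x))) \<le> K ^ j * exp (\<bar>r\<bar> * K)"
  proof (rule AE_I2)
    fix x assume x: "x \<in> space N"
    have R0: "0 \<le> R x" using R_ge[OF x] m_pos by simp
    have "- (r * R x) \<le> \<bar>r\<bar> * R x" using R0 by (metis abs_ge_minus_self abs_mult abs_of_nonneg)
    also have "\<dots> \<le> \<bar>r\<bar> * K" using R_le[OF x] by (simp add: mult_left_mono)
    finally show "norm (R x ^ j * exp (- (r * R x))) \<le> K ^ j * exp (\<bar>r\<bar> * K)"
      using R0 R_le[OF x] by (auto simp: abs_mult intro!: mult_mono power_mono)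
  qed
qed simp

lemma G_Suc_ge: "m * G j r \<le> G (Suc j) r"
proof -
  have "m * G j r = (\<integral>x. m * (R x ^ j * exp (- (r * R x))) \<partial>N)"
    by (simp add: G_def)
  also have "\<dots> \<le> (\<integral>x. R x ^ Suc j * exp (- (r * R x)) \<partial>N)"
  proof (intro integral_mono integrable_mult_right integrable_G)
    fix x assume x: "x \<in> space N"
    have "m * (R x ^ j * exp (- (r * R x))) \<le> R x * (R x ^ j * exp (- (r * R x)))"
      using R_ge[OF x] m_pos by (intro mult_right_mono) auto
    then show "m * (R x ^ j * exp (- (r * R x))) \<le> R x ^ Suc j * exp (- (r * R x))"
      by (simp add: mult.assoc)
  qed
  finally show ?thesis by (simp add: G_def)
qed

lemma G_pos: "G j r > 0"
proof (induction j)
  case 0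
  have "exp (- (\<bar>r\<bar> * K)) * measure N (space N) = (\<integral>x. exp (- (\<bar>r\<bar> * K)) \<partial>N)"
    by simp
  also have "\<dots> \<le> (\<integral>x. R x ^ 0 * exp (- (r * R x)) \<partial>N)"
  proof (intro integral_mono integrable_G)
    fix x assume x: "x \<in> space N"
    have "r * R x \<le> \<bar>r\<bar> * K"
      using R_le[OF x] R_ge[OF x] m_pos by (intro mult_mono) auto
    then show "exp (- (\<bar>r\<bar> * K)) \<le> R x ^ 0 * exp (- (r * R x))" by simp
  qed simp
  finally have "exp (- (\<bar>r\<bar> * K)) * measure N (space N) \<le> G 0 r" by (simp add: G_def)
  then show ?case using nontrivial by (smt (verit) exp_gt_zero mult_pos_pos)
next
  case (Suc j)
  then show ?case using G_Suc_ge[of j r] m_pos by (smt (verit) mult_pos_pos)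
qed

text \<open>
  Differentiation under the integral sign: the pointwise second-order error of the exponential is
  at most \<open>2 (h R)\<^sup>2\<close> once \<open>|h| K \<le> 1/2\<close>, and integrates to a multiple of \<open>h\<^sup>2\<close>.
\<close>

lemma G_deriv: "(G j has_real_derivative - G (Suc j) r) (at r)"
proof (rule has_real_derivative_quadratic_error)
  show "1 / (2 * K) > 0" using K_pos by simp
  fix h :: real assume h: "\<bar>h\<bar> \<le> 1 / (2 * K)"
  let ?e = "\<lambda>x. R x ^ j * exp (- ((r + h) * R x)) - R x ^ j * exp (- (r * R x))
          + h * (R x ^ Suc j * exp (- (r * R x)))"
  have int: "integrable N ?e"
    by (intro integrable_mult_right Bochner_Integration.integrable_add
        Bochner_Integration.integrable_diff integrable_G)
  have "G j (r + h) - G j r - h * - G (Suc j) r = (\<integral>x. ?e x \<partial>N)"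
    unfolding G_def by (simp add: integrable_G del: power_Suc)
  then have "\<bar>G j (r + h) - G j r - h * - G (Suc j) r\<bar> \<le> (\<integral>x. \<bar>?e x\<bar> \<partial>N)"
    by (simp only: integral_abs_bound)
  also have "\<dots> \<le> (\<integral>x. 2 * h\<^sup>2 * (R x ^ (j + 2) * exp (- (r * R x))) \<partial>N)"
  proof (rule integral_mono)
    show "integrable N (\<lambda>x. \<bar>?e x\<bar>)" using int by (rule integrable_abs)
    show "integrable N (\<lambda>x. 2 * h\<^sup>2 * (R x ^ (j + 2) * exp (- (r * R x))))"
      by (intro integrable_mult_right integrable_G)
    fix x assume x: "x \<in> space N"
    have R: "0 \<le> R x" "R x \<le> K" using R_ge[OF x] R_le[OF x] m_pos by simp_all
    have "\<bar>h\<bar> * R x \<le> 1 / (2 * K) * K"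
      using R h by (intro mult_mono) auto
    then have small: "\<bar>- (h * R x)\<bar> \<le> 1 / 2" using K_pos R by (simp add: abs_mult)
    have "?e x = R x ^ j * exp (- (r * R x)) * (exp (- (h * R x)) - 1 - - (h * R x))"
      by (simp add: algebra_simps exp_add exp_diff exp_minus field_simps)
    also have "\<bar>\<dots>\<bar> = R x ^ j * exp (- (r * R x)) * \<bar>exp (- (h * R x)) - 1 - - (h * R x)\<bar>"
      using R by (simp add: abs_mult)
    also have "\<dots> \<le> R x ^ j * exp (- (r * R x)) * (2 * (- (h * R x))\<^sup>2)"
      using R by (intro mult_left_mono exp_quadratic_bound[OF small]) simp
    also have "\<dots> = 2 * h\<^sup>2 * (R x ^ (j + 2) * exp (- (r * R x)))"
      by (simp add: power2_eq_square)
    finally show "\<bar>?e x\<bar> \<le> 2 * h\<^sup>2 * (R x ^ (j + 2) * exp (- (r * R x)))" .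
  qed
  also have "\<dots> = 2 * G (j + 2) r * h\<^sup>2"
    by (simp add: G_def)
  finally show "\<bar>G j (r + h) - G j r - h * - G (Suc j) r\<bar> \<le> 2 * G (j + 2) r * h\<^sup>2" .
qed

lemma G_ratio: "m ^ i * G j r \<le> G (i + j) r"
proof (induction i)
  case (Suc i)
  have "m ^ Suc i * G j r \<le> m * G (i + j) r"
    using Suc m_pos by (simp add: mult.assoc)
  also have "\<dots> \<le> G (Suc i + j) r" using G_Suc_ge by simp
  finally show ?case .
qed simp

text \<open>
  The Leibniz rule. The coefficients are \<open>c\<close> times a binomial coefficient times a falling factorial
  of \<open>a\<close>. They are quantified existentially because the sign for large \<open>\<rho>\<close> is decided by
  \<open>b\<^sub>0 = c\<close> alone.
\<close>

lemma higher_deriv_powr_G: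
  assumes f: "\<And>\<rho>. \<rho> > 0 \<Longrightarrow> f \<rho> = c * \<rho> powr a * G 0 \<rho>"
  shows "\<exists>b. b 0 = c \<and> (\<forall>\<rho>>0. (deriv ^^ j) f \<rho> =
    (\<Sum>i\<le>j. b i * \<rho> powr (a - real i) * ((- 1) ^ (j - i) * G (j - i) \<rho>)))"
proof (induction j)
  case 0
  show ?case using f by (intro exI[of _ "\<lambda>_. c"]) simp
next
  case (Suc j)
  then obtain b where b0: "b 0 = c" and b: "\<And>\<rho>. \<rho> > 0 \<Longrightarrow> (deriv ^^ j) f \<rho> =
    (\<Sum>i\<le>j. b i * \<rho> powr (a - real i) * ((- 1) ^ (j - i) * G (j - i) \<rho>))" by blast
  \<comment> \<open>Differentiating the transform keeps the index \<open>i\<close>, differentiating the power raises it.\<close>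
  define b1 where "b1 i = (if i \<le> j then b i else 0)" for i
  define b2 where "b2 i = (case i of 0 \<Rightarrow> 0 | Suc i \<Rightarrow> b i * (a - real i))" for i
  have "(deriv ^^ Suc j) f \<rho> =
     (\<Sum>i\<le>Suc j. (b1 i + b2 i) * \<rho> powr (a - real i) * ((- 1) ^ (Suc j - i) * G (Suc j - i) \<rho>))" if \<rho>: "\<rho> > 0" for \<rho>
  proof -
    let ?D = "\<lambda>i. b i * \<rho> powr (a - real i) * ((- 1) ^ (Suc j - i) * G (Suc j - i) \<rho>)"
    let ?E = "\<lambda>i. b i * (a - real i) * \<rho> powr (a - real (Suc i)) * ((- 1) ^ (j - i) * G (j - i) \<rho>)"
    have summand: "((\<lambda>\<rho>. b i * \<rho> powr (a - real i) * ((- 1) ^ (j - i) * G (j - i) \<rho>))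
        has_real_derivative ?D i + ?E i) (at \<rho>)" if "i \<le> j" for i
    proof -
      have "Suc j - i = Suc (j - i)" using that by simp
      then show ?thesis
        using \<rho> by (auto intro!: derivative_eq_intros G_deriv simp: algebra_simps)
    qed
    have "((\<lambda>\<rho>. \<Sum>i\<le>j. b i * \<rho> powr (a - real i) * ((- 1) ^ (j - i) * G (j - i) \<rho>))
        has_real_derivative (\<Sum>i\<le>j. ?D i + ?E i)) (at \<rho>)"
      by (rule DERIV_sum) (use summand in auto)
    then have "((deriv ^^ j) f has_real_derivative (\<Sum>i\<le>j. ?D i + ?E i)) (at \<rho>)"
      by (rule has_field_derivative_transform_within_open[where S = "{0<..}"])
         (use \<rho> b in auto)
    then have "(deriv ^^ Suc j) f \<rho> = (\<Sum>i\<le>j. ?D i + ?E i)"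
      by (simp add: DERIV_imp_deriv)
    also have "\<dots> = (\<Sum>i\<le>j. ?D i) + (\<Sum>i\<le>j. ?E i)"
      by (rule sum.distrib)
    also have "(\<Sum>i\<le>j. ?D i) =
        (\<Sum>i\<le>Suc j. b1 i * \<rho> powr (a - real i) * ((- 1) ^ (Suc j - i) * G (Suc j - i) \<rho>))"
      by (simp add: b1_def)
    also have "(\<Sum>i\<le>j. ?E i) =
        (\<Sum>i\<le>Suc j. b2 i * \<rho> powr (a - real i) * ((- 1) ^ (Suc j - i) * G (Suc j - i) \<rho>))"
      by (subst sum.atMost_Suc_shift) (simp add: b2_def)
    finally show ?thesis by (simp add: distrib_right del: sum.atMost_Suc flip: sum.distrib)
  qed
  moreover have "b1 0 + b2 0 = c" by (simp add: b1_def b2_def b0)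
  ultimately show ?case by (intro exI[of _ "\<lambda>i. b1 i + b2 i"]) blast
qed

text \<open>
  Divided by the term with all derivatives on the transform, the term with \<open>i\<close> derivatives on the
  power is \<open>O((m \<rho>)\<^bsup>-i\<^esup>)\<close>, so the quotient tends to \<open>c\<close>.
\<close>

lemma higher_deriv_sign:
  assumes f: "\<And>\<rho>. \<rho> > 0 \<Longrightarrow> f \<rho> = c * \<rho> powr a * G 0 \<rho>" and "c > 0"
  shows "\<forall>\<^sub>F \<rho> in at_top. (- 1) ^ j * (deriv ^^ j) f \<rho> > 0"
proof -
  obtain b where b0: "b 0 = c" and b: "\<And>\<rho>. \<rho> > 0 \<Longrightarrow> (deriv ^^ j) f \<rho> =
    (\<Sum>i\<le>j. b i * \<rho> powr (a - real i) * ((- 1) ^ (j - i) * G (j - i) \<rho>))"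
    using higher_deriv_powr_G[OF f] by blast
  define t where "t i \<rho> = b i * (- 1) ^ i * (\<rho> powr (- real i) * (G (j - i) \<rho> / G j \<rho>))" for i \<rho>
  have lim: "(t i \<longlongrightarrow> (if i = 0 then c else 0)) at_top" if "i \<le> j" for i
  proof (cases "i = 0")
    case True
    have "\<forall>\<^sub>F \<rho> in at_top. t i \<rho> = c"
      using eventually_gt_at_top[of 0] 
    proof eventually_elim
      case (elim \<rho>) 
      then show ?case using True G_pos[of j \<rho>] by (simp add: t_def b0)
    qed
    then show ?thesis using True by (simp add: tendsto_eventually)
  next
    case False
    have "((\<lambda>\<rho>. \<rho> powr (- real i) * (G (j - i) \<rho> / G j \<rho>)) \<longlongrightarrow> 0) at_top"
    proof (rule Lim_null_comparison)
      show "\<forall>\<^sub>F \<rho> in at_top. norm (\<rho> powr (- real i) * (G (j - i) \<rho> / G j \<rho>))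
          \<le> \<rho> powr (- real i) * (1 / m ^ i)"
      proof (intro always_eventually allI)
        fix \<rho>
        have "G (j - i) \<rho> / G j \<rho> \<le> 1 / m ^ i"
          using G_ratio[of i "j - i" \<rho>] that m_pos G_pos[of j \<rho>] by (simp add: field_simps)
        then show "norm (\<rho> powr (- real i) * (G (j - i) \<rho> / G j \<rho>)) \<le> \<rho> powr (- real i) * (1 / m ^ i)"
          using G_pos[of j \<rho>] G_pos[of "j - i" \<rho>]
          by (subst real_norm_def, subst abs_of_nonneg) (auto intro!: mult_left_mono simp del: times_divide_eq_right)
      qed
      show "((\<lambda>\<rho>. \<rho> powr (- real i) * (1 / m ^ i)) \<longlongrightarrow> 0) at_top"
        using False by (intro tendsto_mult_left_zero tendsto_neg_powr filterlim_ident) auto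
    qed
    then have "(t i \<longlongrightarrow> 0) at_top"
      unfolding t_def by (rule tendsto_mult_right_zero)
    then show ?thesis using False by simp
  qed
  have "((\<lambda>\<rho>. \<Sum>i\<le>j. t i \<rho>) \<longlongrightarrow> (\<Sum>i\<le>j. if i = 0 then c else 0)) at_top"
    by (intro tendsto_sum lim) simp
  then have "((\<lambda>\<rho>. \<Sum>i\<le>j. t i \<rho>) \<longlongrightarrow> c) at_top" by simp
  then have "\<forall>\<^sub>F \<rho> in at_top. (\<Sum>i\<le>j. t i \<rho>) > 0"
    using \<open>c > 0\<close> by (rule order_tendstoD)
  then show ?thesis
    using eventually_gt_at_top[of 0]
  proof eventually_elim
    case (elim \<rho>)
    have "(- 1) ^ j * (deriv ^^ j) f \<rho> = \<rho> powr a * G j \<rho> * (\<Sum>i\<le>j. t i \<rho>)"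
      unfolding b[OF elim(2)] sum_distrib_left
    proof (intro sum.cong refl)
      fix i assume "i \<in> {..j}"
      then have sign: "(- 1 :: real) ^ j * (- 1) ^ (j - i) = (- 1) ^ i"
        by (auto simp: uminus_power_if) 
      have pow: "\<rho> powr (a - real i) = \<rho> powr a * \<rho> powr (- real i)"
        by (simp flip: powr_add)
      have "(- 1) ^ j * (b i * \<rho> powr (a - real i) * ((- 1) ^ (j - i) * G (j - i) \<rho>))
          = ((- 1) ^ j * (- 1) ^ (j - i)) * b i * (\<rho> powr a * \<rho> powr (- real i)) * G (j - i) \<rho>"
        unfolding pow by (simp only: mult_ac)
      also have "\<dots> = \<rho> powr a * G j \<rho> * t i \<rho>"
        unfolding sign using G_pos[of j \<rho>] by (simp add: t_def)
      finally show "(- 1) ^ j * (b i * \<rho> powr (a - real i) * ((- 1) ^ (j - i) * G (j - i) \<rho>))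
          = \<rho> powr a * G j \<rho> * t i \<rho>" .
    qed
    then show ?case using elim G_pos[of j \<rho>] by simp
  qed
qed

end

text \<open>
  A Stieltjes-type rule: if the increments of \<open>f\<close> lie between those of \<open>p\<close> weighted by the
  values of \<open>g\<close> at the two end points, then \<open>df = g dp\<close>.
\<close>

lemma has_real_derivative_between:
  fixes f p g :: "real \<Rightarrow> real"
  assumes "x > 0"
    and lower: "\<And>r s. 0 < r \<Longrightarrow> r < s \<Longrightarrow> (p s - p r) * g s \<le> f s - f r"
    and upper: "\<And>r s. 0 < r \<Longrightarrow> r < s \<Longrightarrow> f s - f r \<le> (p s - p r) * g r"
    and p: "(p has_real_derivative p') (at x)" and g: "isCont g x"
  shows "(f has_real_derivative p' * g x) (at x)"
proof -
  let ?q = "\<lambda>y. (p y - p x) / (y - x)"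
  have q: "(?q \<longlongrightarrow> p') (at x)" using p by (simp add: has_field_derivative_iff)
  have g': "(g \<longlongrightarrow> g x) (at x)" using g by (simp add: isCont_def)
  have "((\<lambda>y. (f y - f x) / (y - x)) \<longlongrightarrow> p' * g x) (at x)"
  proof (rule tendsto_sandwich)
    have ev: "\<forall>\<^sub>F y in at x. 0 < y \<and> y \<noteq> x"
      unfolding eventually_at using \<open>x > 0\<close> by (intro exI[of _ x]) (auto simp: dist_real_def)
    have both: "min (?q y * g x) (?q y * g y) \<le> (f y - f x) / (y - x) \<and>
        (f y - f x) / (y - x) \<le> max (?q y * g x) (?q y * g y)" if "0 < y" "y \<noteq> x" for y
    proof (cases "y > x")
      case True
      have "?q y * g y \<le> (f y - f x) / (y - x)" "(f y - f x) / (y - x) \<le> ?q y * g x"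
        using lower[OF \<open>x > 0\<close> True] upper[OF \<open>x > 0\<close> True] True
        by (simp_all add: divide_right_mono)
      then show ?thesis by auto
    next
      case False
      then have "y < x" using that by simp
      have eq: "(f y - f x) / (y - x) = (f x - f y) / (x - y)" "?q y = (p x - p y) / (x - y)"
        by (metis minus_diff_eq minus_divide_divide)+
      have "?q y * g x \<le> (f y - f x) / (y - x)" "(f y - f x) / (y - x) \<le> ?q y * g y"
        unfolding eq using lower[OF \<open>0 < y\<close> \<open>y < x\<close>] upper[OF \<open>0 < y\<close> \<open>y < x\<close>] \<open>y < x\<close>
        by (simp_all add: divide_right_mono)
      then show ?thesis by auto
    qed
    show "\<forall>\<^sub>F y in at x. min (?q y * g x) (?q y * g y) \<le> (f y - f x) / (y - x)"
      using ev by eventually_elim (use both in blast)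
    show "\<forall>\<^sub>F y in at x. (f y - f x) / (y - x) \<le> max (?q y * g x) (?q y * g y)"
      using ev by eventually_elim (use both in blast)
    show "((\<lambda>y. min (?q y * g x) (?q y * g y)) \<longlongrightarrow> p' * g x) (at x)"
      using tendsto_min[OF tendsto_mult[OF q tendsto_const] tendsto_mult[OF q g'], of "g x"] by simp
    show "((\<lambda>y. max (?q y * g x) (?q y * g y)) \<longlongrightarrow> p' * g x) (at x)"
      using tendsto_max[OF tendsto_mult[OF q tendsto_const] tendsto_mult[OF q g'], of "g x"] by simp
  qed
  then show ?thesis by (simp add: has_field_derivative_iff)
qed

section \<open>Gaussian mass of a ball as a function of the squared radius\<close>

lemma emeasure_lborel_scale:
  fixes c :: real
  assumes "c > 0" and [measurable]: "A \<in> sets borel"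
  shows "emeasure lborel A = ennreal c * emeasure lborel ((*) c -` A)"
proof -
  have meas: "(*) c -` A \<in> sets lborel"
    using measurable_sets[of "(*) c" borel borel A] assms by simp
  have "emeasure lborel A = (\<integral>\<^sup>+x. indicator A x \<partial>lborel)"
    by (simp add: nn_integral_indicator)
  also have "\<dots> = ennreal c * (\<integral>\<^sup>+x. indicator A (c * x) \<partial>lborel)"
    using nn_integral_real_affine[of "indicator A" c 0] assms by simp
  also have "(\<integral>\<^sup>+x. indicator A (c * x) \<partial>lborel) = (\<integral>\<^sup>+x. indicator ((*) c -` A) x \<partial>lborel)"
    by (simp add: indicator_def)
  also have "\<dots> = emeasure lborel ((*) c -` A)"
    using meas by (rule nn_integral_indicator)
  finally show ?thesis .
qed

definition dilate :: "nat set \<Rightarrow> real \<Rightarrow> (nat \<Rightarrow> real) \<Rightarrow> nat \<Rightarrow> real" where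
  "dilate I c x = (\<lambda>i\<in>I. c * x i)"

lemma measurable_dilate [measurable]:
  "dilate I c \<in> PiM I (\<lambda>_. lborel) \<rightarrow>\<^sub>M PiM I (\<lambda>_. lborel)"
  unfolding dilate_def[abs_def] by measurable

text \<open>
  Lebesgue measure on \<open>\<real>\<^sup>I\<close> scales by \<open>c\<close> to the number of coordinates. It suffices to compare the
  two measures on boxes.
\<close>

lemma PiM_lborel_dilate:
  assumes I: "finite I" and c: "c > 0"
  shows "scale_measure (ennreal c ^ card I) (distr (PiM I (\<lambda>_. lborel)) (PiM I (\<lambda>_. lborel)) (dilate I c))
    = PiM I (\<lambda>_. lborel)"
proof -
  interpret product_sigma_finite "\<lambda>_ :: nat. lborel :: real measure" by standard
  let ?M = "PiM I (\<lambda>_. lborel :: real measure)"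
  show ?thesis
  proof (rule PiM_eqI[OF I])
    fix A assume A: "\<And>i. i \<in> I \<Longrightarrow> A i \<in> sets (lborel :: real measure)"
    then have A': "\<And>i. i \<in> I \<Longrightarrow> (*) c -` A i \<in> sets lborel"
      using measurable_sets[of "(*) c" borel borel] by simp
    have "dilate I c -` Pi\<^sub>E I A \<inter> space ?M = (\<Pi>\<^sub>E i\<in>I. (*) c -` A i)"
      by (auto simp: dilate_def space_PiM PiE_def Pi_def extensional_def)
    moreover have "Pi\<^sub>E I A \<in> sets ?M"
      using A I by (intro sets_PiM_I_finite) auto
    ultimately have "emeasure (distr ?M ?M (dilate I c)) (Pi\<^sub>E I A) = emeasure ?M (\<Pi>\<^sub>E i\<in>I. (*) c -` A i)"
      by (simp add: emeasure_distr)
    also have "\<dots> = (\<Prod>i\<in>I. emeasure lborel ((*) c -` A i))"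
      using A' by (intro emeasure_PiM I)
    finally show "emeasure (scale_measure (ennreal c ^ card I) (distr ?M ?M (dilate I c))) (Pi\<^sub>E I A)
        = (\<Prod>i\<in>I. emeasure lborel (A i))"
      using A c by (simp add: emeasure_lborel_scale[OF c] prod.distrib)
  qed simp
qed

text \<open>
  Transfer through the extended nonnegative integral: both sides are default values together
  when \<open>f\<close> is not integrable.
\<close>

lemma integral_dilate:
  fixes f :: "(nat \<Rightarrow> real) \<Rightarrow> real"
  assumes I: "finite I" and c: "c > 0"
    and f [measurable]: "f \<in> borel_measurable (PiM I (\<lambda>_. lborel))" and nn: "\<And>x. f x \<ge> 0"
  shows "(\<integral>x. f x \<partial>PiM I (\<lambda>_. lborel)) = c ^ card I * (\<integral>x. f (dilate I c x) \<partial>PiM I (\<lambda>_. lborel))"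
proof -
  let ?M = "PiM I (\<lambda>_. lborel :: real measure)"
  have "(\<integral>\<^sup>+x. ennreal (f x) \<partial>?M) =
      (\<integral>\<^sup>+x. ennreal (f x) \<partial>scale_measure (ennreal c ^ card I) (distr ?M ?M (dilate I c)))"
    by (simp only: PiM_lborel_dilate[OF I c])
  also have "\<dots> = ennreal c ^ card I * (\<integral>\<^sup>+x. ennreal (f (dilate I c x)) \<partial>?M)"
    by (simp add: nn_integral_scale_measure nn_integral_distr)
  also have "ennreal c ^ card I = ennreal (c ^ card I)"
    using c by (simp add: ennreal_power)
  finally show ?thesis
    using c nn by (simp add: integral_eq_nn_integral enn2real_mult)
qed

locale gaussian_ball =
  fixes I :: "nat set" and \<mu> :: "nat \<Rightarrow> real"
  assumes fin: "finite I" and ne: "I \<noteq> {}" and \<mu>_pos: "\<And>i. i \<in> I \<Longrightarrow> \<mu> i > 0"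
begin

abbreviation M where "M \<equiv> PiM I (\<lambda>_. lborel :: real measure)"

definition sq :: "(nat \<Rightarrow> real) \<Rightarrow> real" where "sq x = (\<Sum>i\<in>I. (x i)\<^sup>2)"
definition Q :: "(nat \<Rightarrow> real) \<Rightarrow> real" where "Q x = (\<Sum>i\<in>I. (x i)\<^sup>2 / (2 * \<mu> i))"
definition m :: real where "m = Min ((\<lambda>i. 1 / (2 * \<mu> i)) ` I)"
definition K :: real where "K = Max ((\<lambda>i. 1 / (2 * \<mu> i)) ` I)"
text \<open>
  The exponent divided by the squared radius, a function of the direction only. The value at the
  origin is chosen so that the bounds \<open>m \<le> R \<le> K\<close> hold everywhere.
\<close>

definition R :: "(nat \<Rightarrow> real) \<Rightarrow> real" where "R x = (if sq x = 0 then m else Q x / sq x)"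
definition C :: real where "C = (\<Prod>i\<in>I. (2 * pi * \<mu> i) powr (- 1 / 2))"

lemma measurable_sq [measurable]: "sq \<in> borel_measurable M"
  and measurable_Q [measurable]: "Q \<in> borel_measurable M"
  unfolding sq_def[abs_def] Q_def[abs_def] by measurable

lemma measurable_R [measurable]: "R \<in> borel_measurable M"
  unfolding R_def[abs_def] by measurable

lemma ball_eq: "ball_I I r = {x \<in> space M. sq x < r}"
  by (simp add: ball_I_def sq_def space_PiM)

lemma ball_sets [measurable]: "ball_I I r \<in> sets M"
  unfolding ball_eq by measurable

lemma sq_nonneg: "sq x \<ge> 0"
  by (simp add: sq_def sum_nonneg)

lemma m_pos: "m > 0"
  unfolding m_def using fin ne \<mu>_pos by (subst Min_gr_iff) auto

lemma Q_bounds: "m * sq x \<le> Q x" "Q x \<le> K * sq x"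
proof -
  have "m * (x i)\<^sup>2 \<le> (x i)\<^sup>2 / (2 * \<mu> i) \<and> (x i)\<^sup>2 / (2 * \<mu> i) \<le> K * (x i)\<^sup>2" if "i \<in> I" for i
  proof -
    have "m \<le> 1 / (2 * \<mu> i)" "1 / (2 * \<mu> i) \<le> K"
      unfolding m_def K_def using fin that by (auto intro!: Min_le Max_ge)
    from this[THEN mult_right_mono, OF zero_le_power2[of "x i"]]
    show ?thesis by simp
  qed
  then show "m * sq x \<le> Q x" "Q x \<le> K * sq x"
    unfolding sq_def Q_def sum_distrib_left by (auto intro!: sum_mono)
qed

lemma R_sq: "R x * sq x = Q x"
  using Q_bounds[of x] by (auto simp: R_def)

lemma R_bounds: "m \<le> R x" "R x \<le> K"
proof -
  have "m \<le> K"
  proof -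
    obtain i where "i \<in> I" using ne by blast
    then have "m \<le> 1 / (2 * \<mu> i)" "1 / (2 * \<mu> i) \<le> K"
      unfolding m_def K_def using fin by (auto intro!: Min_le Max_ge)
    then show ?thesis by simp
  qed
  then show "m \<le> R x" "R x \<le> K"
    using Q_bounds[of x] sq_nonneg[of x] by (auto simp: R_def field_simps)
qed

lemma sq_dilate: "sq (dilate I c x) = c\<^sup>2 * sq x"
  by (simp add: sq_def dilate_def power_mult_distrib sum_distrib_left)

lemma R_dilate: "c > 0 \<Longrightarrow> R (dilate I c x) = R x"
proof -
  have "Q (dilate I c x) = c\<^sup>2 * Q x"
    by (simp add: Q_def dilate_def power_mult_distrib sum_distrib_left)
  then show "c > 0 \<Longrightarrow> R (dilate I c x) = R x"
    by (simp add: R_def sq_dilate)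
qed

lemma emeasure_box: "b > 0 \<Longrightarrow> emeasure M (\<Pi>\<^sub>E i\<in>I. {- b..b}) = ennreal ((2 * b) ^ card I)"
proof -
  interpret product_sigma_finite "\<lambda>_ :: nat. lborel :: real measure" by standard
  show "b > 0 \<Longrightarrow> ?thesis"
    using fin by (simp add: emeasure_PiM ennreal_power)
qed

lemma emeasure_ball_finite: "emeasure M (ball_I I r) < \<infinity>"
proof -
  let ?b = "sqrt \<bar>r\<bar> + 1"
  have "ball_I I r \<subseteq> (\<Pi>\<^sub>E i\<in>I. {- ?b..?b})"
  proof
    fix x assume x: "x \<in> ball_I I r"
    have "x i \<in> {- ?b..?b}" if "i \<in> I" for i
    proof -
      have "(x i)\<^sup>2 \<le> sq x" unfolding sq_def using fin that by (intro member_le_sum) auto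
      also have "sq x < r" using x by (simp add: ball_eq)
      also have "r \<le> \<bar>r\<bar>" by simp
      finally have "\<bar>x i\<bar> \<le> sqrt \<bar>r\<bar>" by (simp add: real_le_rsqrt)
      then show ?thesis by auto
    qed
    then show "x \<in> (\<Pi>\<^sub>E i\<in>I. {- ?b..?b})"
      using x by (auto simp: ball_I_def PiE_def)
  qed
  moreover have "(\<Pi>\<^sub>E i\<in>I. {- ?b..?b}) \<in> sets M"
    using fin by (intro sets_PiM_I_finite) auto
  ultimately have "emeasure M (ball_I I r) \<le> emeasure M (\<Pi>\<^sub>E i\<in>I. {- ?b..?b})"
    by (rule emeasure_mono)
  also have "\<dots> < \<infinity>"
    by (subst emeasure_box) (auto intro: add_nonneg_pos)
  finally show ?thesis .
qed

text \<open>
  The ball contains a cube of half side \<open>b = 1/(d+1)\<close>, because \<open>d b\<^sup>2 < 1\<close>.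
\<close>

lemma emeasure_unit_ball_pos: "emeasure M (ball_I I 1) > 0"
proof -
  define b where "b = 1 / (real (card I) + 1)"
  have b: "b > 0" by (simp add: b_def add_nonneg_pos)
  have card: "card I > 0" using fin ne by (simp add: card_gt_0_iff)
  have "(\<Pi>\<^sub>E i\<in>I. {- b..b}) \<subseteq> ball_I I 1"
  proof
    fix x assume x: "x \<in> (\<Pi>\<^sub>E i\<in>I. {- b..b})"
    have "(x i)\<^sup>2 \<le> b\<^sup>2" if "i \<in> I" for i
      using x that by (intro abs_le_square_iff[THEN iffD1]) (auto simp: PiE_def Pi_def abs_le_iff)
    then have "sq x \<le> (\<Sum>i\<in>I. b\<^sup>2)" unfolding sq_def by (intro sum_mono)
    also have "\<dots> = real (card I) * b * b" by (simp add: power2_eq_square)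
    also have "\<dots> < 1"
    proof -
      have "real (card I) * b < 1" "b \<le> 1" by (simp_all add: b_def field_simps)
      then have "real (card I) * b * b \<le> real (card I) * b * 1" using b by (intro mult_left_mono) auto
      then show ?thesis using \<open>real (card I) * b < 1\<close> by simp
    qed
    finally show "x \<in> ball_I I 1" using x by (auto simp: ball_I_def sq_def PiE_def)
  qed
  then have "emeasure M (\<Pi>\<^sub>E i\<in>I. {- b..b}) \<le> emeasure M (ball_I I 1)"
    by (intro emeasure_mono) auto
  moreover have "emeasure M (\<Pi>\<^sub>E i\<in>I. {- b..b}) > 0"
    using b by (simp add: emeasure_box)
  ultimately show ?thesis by simp
qed

definition N where "N = restrict_space M (ball_I I 1)"

lemma integral_N: "(\<integral>x. f x \<partial>N) = (\<integral>x. indicator (ball_I I 1) x * f x \<partial>M)" for f :: "_ \<Rightarrow> real"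
  unfolding N_def by (subst integral_restrict_space) auto

sublocale unit: bounded_rate N R m K
proof (intro bounded_rate.intro bounded_rate_axioms.intro)
  have sp: "space N = ball_I I 1"
    using sets.sets_into_space[OF ball_sets, of 1] by (auto simp: N_def space_restrict_space)
  have em: "emeasure N (space N) = emeasure M (ball_I I 1)"
    unfolding sp unfolding N_def by (rule emeasure_restrict_space) auto
  show "finite_measure N"
    by (rule finite_measureI) (use emeasure_ball_finite[of 1] in \<open>simp add: em\<close>)
  show "R \<in> borel_measurable N"
    unfolding N_def by (rule measurable_restrict_space1) simp
  show "measure N (space N) > 0"
    using emeasure_ball_finite[of 1] emeasure_unit_ball_pos
    by (simp add: measure_def em enn2real_positive_iff)
qed (use m_pos R_bounds in auto)

lemma integrable_ball:
  fixes f :: "(nat \<Rightarrow> real) \<Rightarrow> real"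
  assumes [measurable]: "f \<in> borel_measurable M" and "\<And>x. \<bar>f x\<bar> \<le> B"
  shows "integrable M (\<lambda>x. indicator (ball_I I r) x * f x)"
proof (rule Bochner_Integration.integrable_bound)
  show "integrable M (\<lambda>x. B * indicator (ball_I I r) x)"
    using emeasure_ball_finite[of r] by (intro integrable_mult_right integrable_real_indicator) auto
  show "AE x in M. norm (indicator (ball_I I r) x * f x) \<le> norm (B * indicator (ball_I I r) x)"
    using order_trans[OF assms(2) abs_ge_self] by (intro AE_I2) (auto simp: indicator_def)
qed simp

text \<open>
  Dilation by \<open>\<surd>s\<close> maps the unit ball to the ball of squared radius \<open>s\<close> and leaves \<open>R\<close> fixed.
\<close>

lemma integral_ball_R:
  assumes "s > 0"
  shows "(\<integral>x. indicator (ball_I I s) x * exp (- (r * R x)) \<partial>M)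
    = s powr (real (card I) / 2) * unit.G 0 r"
proof -
  let ?c = "sqrt s"
  have c: "?c > 0" using assms by simp
  have "(\<integral>x. indicator (ball_I I s) x * exp (- (r * R x)) \<partial>M)
     = ?c ^ card I * (\<integral>x. indicator (ball_I I s) (dilate I ?c x) * exp (- (r * R (dilate I ?c x))) \<partial>M)"
    by (rule integral_dilate[OF fin c]) auto
  also have "(\<integral>x. indicator (ball_I I s) (dilate I ?c x) * exp (- (r * R (dilate I ?c x))) \<partial>M)
     = (\<integral>x. indicator (ball_I I 1) x * exp (- (r * R x)) \<partial>M)"
  proof (rule Bochner_Integration.integral_cong[OF refl])
    fix x assume x: "x \<in> space M"
    then have "dilate I ?c x \<in> space M"
      by (auto simp: dilate_def space_PiM)
    then have "dilate I ?c x \<in> ball_I I s \<longleftrightarrow> x \<in> ball_I I 1"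
      using x assms by (simp add: ball_eq sq_dilate)
    then show "indicator (ball_I I s) (dilate I ?c x) * exp (- (r * R (dilate I ?c x)))
        = indicator (ball_I I 1) x * exp (- (r * R x))"
      by (simp add: R_dilate[OF c] indicator_def)
  qed
  also have "\<dots> = unit.G 0 r" by (simp add: unit.G_def integral_N)
  also have "?c ^ card I = s powr (real (card I) / 2)"
    using assms by (simp add: powr_half_sqrt[symmetric] powr_powr flip: powr_realpow)
  finally show ?thesis .
qed

lemma alpha_eq: "alpha I r \<mu> = C * (\<integral>x. indicator (ball_I I r) x * exp (- Q x) \<partial>M)"
proof -
  have "(\<Prod>j\<in>I. gauss (x j) (\<mu> j)) = C * exp (- Q x)" for x
    by (simp add: gauss_def prod.distrib C_def Q_def exp_sum[OF fin] flip: sum_negf)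
  then have "alpha I r \<mu> = (\<integral>x. C * (indicator (ball_I I r) x * exp (- Q x)) \<partial>M)"
    by (simp add: alpha_def set_lebesgue_integral_def mult.left_commute)
  then show ?thesis by simp
qed

lemma C_pos: "C > 0"
proof -
  have "(2 * pi * \<mu> i) powr (- 1 / 2) > 0" if "i \<in> I" for i
    using \<mu>_pos[OF that] by simp
  then show ?thesis unfolding C_def by (rule prod_pos)
qed

lemma Q_nonneg: "Q x \<ge> 0"
  using Q_bounds(1)[of x] sq_nonneg[of x] m_pos by (meson mult_nonneg_nonneg less_imp_le order_trans)

lemma integrable_Q: "integrable M (\<lambda>x. indicator (ball_I I r) x * exp (- Q x))"
  by (rule integrable_ball[where B = 1]) (simp_all add: Q_nonneg)

lemma integrable_R: "r > 0 \<Longrightarrow> integrable M (\<lambda>x. indicator (ball_I I s) x * exp (- (r * R x)))"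
  by (rule integrable_ball[where B = 1])
     (auto intro!: mult_nonneg_nonneg less_imp_le[OF less_le_trans[OF m_pos R_bounds(1)]])

text \<open>
  On the shell \<open>r \<le> |x|\<^sup>2 < s\<close> the exponent \<open>|x|\<^sup>2 R\<close> lies between \<open>r R\<close> and \<open>s R\<close>, and the shell
  integrals of \<open>exp(-r R)\<close> and \<open>exp(-s R)\<close> are known by scaling.
\<close>

lemma alpha_increment:
  assumes "0 < r" "r < s"
  defines "p \<equiv> \<lambda>s. s powr (real (card I) / 2)"
  shows "(p s - p r) * (C * unit.G 0 s) \<le> alpha I s \<mu> - alpha I r \<mu>"
    and "alpha I s \<mu> - alpha I r \<mu> \<le> (p s - p r) * (C * unit.G 0 r)"
proof -
  let ?i = "\<lambda>s x. indicator (ball_I I s) x :: real"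
  have "s > 0" using assms by simp
  have diff: "alpha I s \<mu> - alpha I r \<mu> = C * (\<integral>x. ?i s x * exp (- Q x) - ?i r x * exp (- Q x) \<partial>M)"
    by (simp add: alpha_eq integrable_Q right_diff_distrib)
  have shell: "(p s - p r) * unit.G 0 t = (\<integral>x. ?i s x * exp (- (t * R x)) - ?i r x * exp (- (t * R x)) \<partial>M)"
    if "t > 0" for t
    using that assms \<open>s > 0\<close> by (simp add: integrable_R integral_ball_R p_def left_diff_distrib)
  have pw: "?i s x * exp (- (s * R x)) - ?i r x * exp (- (s * R x)) \<le> ?i s x * exp (- Q x) - ?i r x * exp (- Q x)
     \<and> ?i s x * exp (- Q x) - ?i r x * exp (- Q x) \<le> ?i s x * exp (- (r * R x)) - ?i r x * exp (- (r * R x))"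
    if "x \<in> space M" for x
  proof (cases "r \<le> sq x \<and> sq x < s")
    case True
    have R: "R x \<ge> 0" using R_bounds(1)[of x] m_pos by simp
    have "r * R x \<le> Q x" "Q x \<le> s * R x"
      using True R mult_left_mono[of r "sq x" "R x"] mult_left_mono[of "sq x" s "R x"]
      by (simp_all add: R_sq[symmetric] mult.commute)
    then show ?thesis using True that by (simp add: ball_eq indicator_def)
  next
    case False
    then have "x \<in> ball_I I s \<longleftrightarrow> x \<in> ball_I I r"
      using assms that by (auto simp: ball_eq)
    then show ?thesis by (simp add: indicator_def)
  qed
  have "(p s - p r) * unit.G 0 s \<le> (\<integral>x. ?i s x * exp (- Q x) - ?i r x * exp (- Q x) \<partial>M)"
    unfolding shell[OF \<open>s > 0\<close>]
    by (intro integral_mono Bochner_Integration.integrable_diff integrable_Q integrable_R \<open>s > 0\<close>)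
       (use pw in blast)
  then show "(p s - p r) * (C * unit.G 0 s) \<le> alpha I s \<mu> - alpha I r \<mu>"
    unfolding diff using C_pos by (simp add: mult.left_commute[of _ C])
  have "(\<integral>x. ?i s x * exp (- Q x) - ?i r x * exp (- Q x) \<partial>M) \<le> (p s - p r) * unit.G 0 r"
    unfolding shell[OF \<open>0 < r\<close>]
    by (intro integral_mono Bochner_Integration.integrable_diff integrable_Q integrable_R \<open>0 < r\<close>)
       (use pw in blast)
  then show "alpha I s \<mu> - alpha I r \<mu> \<le> (p s - p r) * (C * unit.G 0 r)"
    unfolding diff using C_pos by (simp add: mult.left_commute[of _ C])
qed

lemma alpha_deriv:
  assumes "\<rho> > 0"
  shows "((\<lambda>r. alpha I r \<mu>) has_real_derivative
    real (card I) / 2 * C * \<rho> powr (real (card I) / 2 - 1) * unit.G 0 \<rho>) (at \<rho>)"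
proof -
  let ?h = "real (card I) / 2"
  have p: "((\<lambda>s. s powr ?h) has_real_derivative ?h * \<rho> powr (?h - 1)) (at \<rho>)"
    using assms by (rule has_real_derivative_powr)
  have "isCont (\<lambda>r. C * unit.G 0 r) \<rho>"
    by (intro continuous_intros DERIV_isCont[OF unit.G_deriv])
  from has_real_derivative_between[OF assms alpha_increment p this]
  show ?thesis by (simp add: mult_ac)
qed

lemma alpha_pos:
  assumes "\<rho> > 0"
  shows "alpha I \<rho> \<mu> > 0"
proof -
  let ?i = "\<lambda>x. indicator (ball_I I \<rho>) x :: real"
  have "0 < \<rho> powr (real (card I) / 2) * unit.G 0 \<rho>"
    using assms unit.G_pos by simp
  also have "\<dots> = (\<integral>x. ?i x * exp (- (\<rho> * R x)) \<partial>M)"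
    using assms by (simp add: integral_ball_R)
  also have "\<dots> \<le> (\<integral>x. ?i x * exp (- Q x) \<partial>M)"
  proof (intro integral_mono integrable_R integrable_Q assms)
    fix x
    have "Q x \<le> \<rho> * R x" if "sq x < \<rho>"
      using that R_bounds(1)[of x] m_pos mult_left_mono[of "sq x" \<rho> "R x"]
      by (simp add: R_sq[symmetric] mult.commute)
    then show "?i x * exp (- (\<rho> * R x)) \<le> ?i x * exp (- Q x)"
      by (simp add: ball_eq indicator_def)
  qed
  finally show ?thesis using C_pos by (simp add: alpha_eq)
qed

text \<open>
  One derivative is used up by passing from the mass of the ball to its radial density; the
  remaining \<open>k - 1\<close> each contribute a sign.
\<close>

lemma eta_sign:
  assumes "k > 0"
  shows "\<forall>\<^sub>F \<rho> in at_top. (- 1) ^ (k - 1) * eta I k \<rho> \<mu> > 0"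
proof -
  obtain j where k: "k = Suc j" using assms by (cases k) auto
  let ?c = "real (card I) / 2 * C"
  have c: "?c > 0" using fin ne C_pos by (simp add: card_gt_0_iff)
  have "deriv (\<lambda>r. alpha I r \<mu>) \<rho> = ?c * \<rho> powr (real (card I) / 2 - 1) * unit.G 0 \<rho>"
    if "\<rho> > 0" for \<rho>
    using alpha_deriv[OF that] by (rule DERIV_imp_deriv)
  from unit.higher_deriv_sign[OF this c]
  have "\<forall>\<^sub>F \<rho> in at_top. (- 1) ^ j * (deriv ^^ j) (deriv (\<lambda>r. alpha I r \<mu>)) \<rho> > 0" .
  then show ?thesis
    using eventually_gt_at_top[of 0]
  proof eventually_elim
    case (elim \<rho>)
    have "(- 1) ^ (k - 1) * eta I k \<rho> \<mu>
      = \<rho> ^ k / alpha I \<rho> \<mu> * ((- 1) ^ j * (deriv ^^ j) (deriv (\<lambda>r. alpha I r \<mu>)) \<rho>)"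
      by (simp add: eta_def k funpow_Suc_right del: funpow.simps)
    then show ?case using elim alpha_pos[of \<rho>] by simp
  qed
qed

end

section \<open>Signs of the terms of the expansion\<close>

lemma mdeg_sum: "finite I \<Longrightarrow> mdeg (\<Sum>k\<in>I. Poly_Mapping.single k (e k)) = (\<Sum>k\<in>I. e k)"
  and mweight_sum: "finite I \<Longrightarrow> mweight (\<Sum>k\<in>I. Poly_Mapping.single k (e k)) = (\<Sum>k\<in>I. k * e k)"
  by (induction I rule: finite_induct)
     (simp_all add: mdeg_add mweight_add mweight_single, simp_all add: mdeg_def mweight_def)

lemma lookup_series_Delta_0:
  "lookup (fps_nth (series_Delta a) 0) 0 = (a 2 * a 0 - (a 1)\<^sup>2 - 2 * a 1 * a 0) / (a 0)\<^sup>2"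
proof -
  have A: "fps_nth (moment_series a k) 0 = Poly_Mapping.single 0 (a k)" for k
    by (simp add: nth_moment_series Yexp_def)
  have B: "fps_nth (series_inverse a) 0 = Poly_Mapping.single 0 (1 / a 0)"
    by (simp add: series_inverse_def Yconst_def)
  have "fps_nth (series_Delta a) 0 = Poly_Mapping.single 0
      ((a 2 * a 0 - a 1 * a 1 - (a 1 + a 1) * a 0) * (1 / a 0 * (1 / a 0)))"
    by (simp only: series_Delta_def power2_eq_square mult_2 fps_mult_nth_0 fps_sub_nth fps_add_nth
        A B mult_single single_diff[symmetric] single_add[symmetric] add_0)
  then show ?thesis by (simp add: power2_eq_square)
qed

text \<open>
  For \<open>q > 0\<close> the limit of the coefficient is already nonzero. For \<open>q = 0\<close> the monomial is \<open>1\<close>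
  and the limit is \<open>0\<close>, so the sign is read off at finite \<open>\<rho>\<close>.
\<close>

lemma signed_coeff_wte_Delta_neg:
  assumes l: "l > 0" and s: "0 \<notin> keys s" "mweight s = q"
  shows "\<forall>\<^sub>F \<rho> in at_top. signed_coeff (wte_Delta \<rho> l) q s < 0"
proof (cases "q = 0")
  case True
  have "keys s = {}"
  proof (rule ccontr)
    assume "keys s \<noteq> {}"
    then obtain k where "k \<in> keys s" by blast
    with s True show False using split_variable[of k s] by (metis add_is_0 less_numeral_extra(3))
  qed
  then have [simp]: "s = 0" by simp
  show ?thesis
    using Delta_order_zero_neg[OF l] eventually_gt_at_top[of 0]
  proof eventually_elim
    case (elim \<rho>)
    then show ?case
      using alpha1_0_pos[OF elim(2) l] True
      by (simp add: signed_coeff_def mdeg_def wte_Delta_eq lookup_series_Delta_0 divide_neg_pos)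
  qed
next
  case False
  have "((\<lambda>\<rho>. signed_coeff (wte_Delta \<rho> l) q s) \<longlongrightarrow> signed_coeff (series_Delta normal_even_moment) q s) at_top"
    using coeffs_tendsto_series_Delta[where a = "\<lambda>\<rho> j. alpha1 j \<rho> l", OF alpha1_tendsto[OF l]]
    unfolding signed_coeff_def wte_Delta_eq coeffs_tendsto_def by (intro tendsto_mult_left) simp
  moreover have "signed_coeff (series_Delta normal_even_moment) q s < 0"
    using s False by (intro signed_coeff_Delta_neg normal_even_moment_pos) auto
  ultimately show ?thesis by (rule order_tendstoD(2))
qed

text \<open>
  The factor \<open>(-1)\<^sup>q\<close> in the definition of \<open>Xi\<close> is one half of the twist in \<open>signed_coeff\<close>; the
  other half is the sign of the degree.
\<close>

lemma Xi_sign: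
  assumes "l > 0" and q: "(\<Sum>k=1..q. k * e k) = q"
  shows "\<forall>\<^sub>F \<rho> in at_top. (- 1) ^ (\<Sum>k=1..q. e k) * Xi q e \<rho> l < 0"
proof -
  define s where "s = (\<Sum>k=1..q. Poly_Mapping.single k (e k))"
  have "0 \<notin> keys s"
    by (simp add: s_def in_keys_iff lookup_sum lookup_single when_def)
  moreover have "mweight s = q" using q by (simp add: s_def mweight_sum)
  ultimately have "\<forall>\<^sub>F \<rho> in at_top. signed_coeff (wte_Delta \<rho> l) q s < 0"
    by (rule signed_coeff_wte_Delta_neg[OF \<open>l > 0\<close>])
  moreover have "signed_coeff (wte_Delta \<rho> l) q s = (- 1) ^ (\<Sum>k=1..q. e k) * Xi q e \<rho> l" for \<rho>
    by (simp add: signed_coeff_def Xi_def power_add mdeg_sum flip: s_def)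
       (simp add: s_def mdeg_sum)
  ultimately show ?thesis by simp
qed

theorem theorem5p1:
  fixes v n q :: nat and lam :: "nat \<Rightarrow> real" and e :: "nat \<Rightarrow> nat"
  assumes "v \<ge> 2"
    and "\<And>k. k \<in> {1..v} \<Longrightarrow> lam k > 0"
    and "n \<in> {1..v}"
    and "(\<Sum>k=1..q. k * e k) = q"
  shows "((\<lambda>\<rho>. sgn (Xi q e \<rho> (lam n))) \<longlongrightarrow> (- 1) powi (int (\<Sum>k=1..q. e k) - 1)) at_top
    \<and> (\<exists>\<rho>'>0. \<forall>\<rho>>\<rho>'.
          (lam n)\<^sup>2 / \<rho>\<^sup>2 * (- 1) ^ q * (lam n / \<rho>) ^ q * Xi q e \<rho> (lam n)
            * (\<Prod>k=1..q. eta ({1..v} - {n}) k \<rho> lam ^ e k) < 0)"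
proof
  let ?d = "\<Sum>k=1..q. e k" and ?I = "{1..v} - {n}"
  have l: "lam n > 0" using assms by blast
  note Xi = Xi_sign[OF l assms(4)]
  have "\<forall>\<^sub>F \<rho> in at_top. sgn (Xi q e \<rho> (lam n)) = (- 1) powi (int ?d - 1)"
    using Xi
  proof eventually_elim
    case (elim \<rho>)
    have "sgn (Xi q e \<rho> (lam n)) = - ((- 1) ^ ?d)"
      using elim by (cases "even ?d") auto
    also have "- ((- 1 :: real) ^ d) = (- 1) powi (int d - 1)" for d
      by (simp add: power_int_diff)
    finally show ?case .
  qed
  then show "((\<lambda>\<rho>. sgn (Xi q e \<rho> (lam n))) \<longlongrightarrow> (- 1) powi (int ?d - 1)) at_top"
    by (rule tendsto_eventually)
  \<comment> \<open>The total sign \<open>(-1)\<^sup>w\<close> of the product of the \<open>\<eta>\<^sub>k\<close>; with the degree it accounts for \<open>(-1)\<^sup>q\<close>.\<close>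
  define w where "w = (\<Sum>k=1..q. (k - 1) * e k)"
  have w: "w + ?d = q"
  proof -
    have "(k - 1) * e k + e k = k * e k" if "k \<in> {1..q}" for k
      using that by (cases k) auto
    then show ?thesis
      unfolding w_def sum.distrib[symmetric] using assms(4) by (metis (no_types, lifting) sum.cong)
  qed
  have "card ?I = v - 1" using assms(3) by simp
  then have "?I \<noteq> {}" using assms(1) by (metis card.empty diff_is_0_eq not_numeral_le_zero
      numeral_le_one_iff order_trans semiring_norm(69))
  then interpret gaussian_ball ?I lam
    by unfold_locales (use assms(2) in auto)
  have "\<forall>\<^sub>F \<rho> in at_top. \<forall>k\<in>{1..q}. (- 1) ^ (k - 1) * eta ?I k \<rho> lam > 0"
    by (intro eventually_ball_finite ballI eta_sign) auto
  with Xi have "\<forall>\<^sub>F \<rho> in at_top. (lam n)\<^sup>2 / \<rho>\<^sup>2 * (- 1) ^ q * (lam n / \<rho>) ^ q * Xi q e \<rho> (lam n)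
            * (\<Prod>k=1..q. eta ?I k \<rho> lam ^ e k) < 0"
    using eventually_gt_at_top[of 0]
  proof eventually_elim
    case (elim \<rho>)
    let ?P = "\<Prod>k=1..q. eta ?I k \<rho> lam ^ e k"
    have "0 < (\<Prod>k=1..q. ((- 1) ^ (k - 1) * eta ?I k \<rho> lam) ^ e k)"
      using elim by (intro prod_pos) auto
    also have "\<dots> = (- 1) ^ w * ?P"
      by (simp add: w_def power_mult_distrib prod.distrib power_sum flip: power_mult)
    finally have P: "0 < (- 1) ^ w * ?P" .
    have "(lam n)\<^sup>2 / \<rho>\<^sup>2 * (- 1) ^ q * (lam n / \<rho>) ^ q * Xi q e \<rho> (lam n) * ?P
        = (lam n)\<^sup>2 / \<rho>\<^sup>2 * (lam n / \<rho>) ^ q * ((- 1) ^ w * ?P) * ((- 1) ^ ?d * Xi q e \<rho> (lam n))"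
      by (subst w[symmetric], subst power_add) (simp add: mult_ac)
    also have "\<dots> < 0"
      using l elim by (intro mult_pos_neg[OF mult_pos_pos[OF _ P] elim(1)]) simp
    finally show ?case .
  qed
  then obtain b where b: "\<And>\<rho>. \<rho> > b \<Longrightarrow> (lam n)\<^sup>2 / \<rho>\<^sup>2 * (- 1) ^ q * (lam n / \<rho>) ^ q * Xi q e \<rho> (lam n)
            * (\<Prod>k=1..q. eta ?I k \<rho> lam ^ e k) < 0"
    unfolding eventually_at_top_dense by blast
  show "\<exists>\<rho>'>0. \<forall>\<rho>>\<rho>'. (lam n)\<^sup>2 / \<rho>\<^sup>2 * (- 1) ^ q * (lam n / \<rho>) ^ q * Xi q e \<rho> (lam n)
            * (\<Prod>k=1..q. eta ?I k \<rho> lam ^ e k) < 0"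
    by (rule exI[of _ "max b 1"]) (use b in auto)
qed

end
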